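(* Let $f(x)=a_rx^r+\cdots+a_1x+a_0$ be a non-constant polynomial with integer coefficients and with $a_r\ge 1$. Then for every colouring of $\mathbb{R}^2$ with finitely many colours, there exist two distinct points of the same colour whose Euclidean distance from each other is equal to $f(n)$ for some integer $n$. *)

theory Defs
  imports "HOL-Analysis.Analysis" "HOL-Computational_Algebra.Polynomial"
begin

end

theory Submission
  imports Defs
begin

text \<open>
  For a large number \<open>b\<close> divisible by all small integers let \<open>u\<close> be the unit complex number with
  \<open>u + 1 / u = 1 / b\<close>. The displacements \<open>f n * u ^ j\<close> with \<open>j < J\<close> lie in a planar lattice, so a
  character of the lattice turns \<open>u ^ j\<close> into phases \<open>\<theta> j\<close> that satisfy
  \<open>b * \<theta> (j + 2) + b * \<theta> j = \<theta> (j + 1)\<close>. By Weyl's inequality the average over \<open>n < N\<close> of the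
  character at \<open>f n * u ^ j\<close> is small unless \<open>\<theta> j\<close> is within \<open>O(1 / N ^ r)\<close>, with \<open>r\<close> the degree
  of \<open>f\<close>, of a rational number with small denominator, which therefore divides \<open>b\<close>. If this happens
  for three indices \<open>i < j < k\<close>, then the recurrence forces \<open>\<theta> j\<close> itself to be close to an integer,
  where the average has nonnegative real part for all but one of several widely separated scales \<open>N\<close>.
  Hence the averaged displacement measure has a Fourier transform whose real part is everywhere at
  least \<open>- \<epsilon>\<close>, and Hoffman's ratio bound excludes proper colourings with fewer than \<open>1 / \<epsilon>\<close> colours.
\<close>

section \<open>The additive character and approximation by integers\<close>

definition ep :: "real \<Rightarrow> complex" where
  "ep x = cis (2 * pi * x)"

definition near_int :: "real \<Rightarrow> real \<Rightarrow> bool" where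
  "near_int \<eta> x \<longleftrightarrow> (\<exists>z::int. \<bar>x - of_int z\<bar> \<le> \<eta>)"

lemma norm_ep [simp]: "cmod (ep x) = 1"
  by (simp add: ep_def)

lemma ep_0 [simp]: "ep 0 = 1"
  by (simp add: ep_def)

lemma ep_add: "ep (x + y) = ep x * ep y"
  by (simp add: ep_def cis_mult algebra_simps)

lemma ep_minus: "ep (- x) = cnj (ep x)"
  by (simp add: ep_def cis_cnj)

lemma ep_diff: "ep (x - y) = ep x * cnj (ep y)"
  using ep_add[of x "- y"] by (simp add: ep_minus)

lemma ep_of_int [simp]: "ep (of_int z) = 1"
  by (simp add: ep_def cis_multiple_2pi)

lemma ep_mult_of_nat: "ep (of_nat n * x) = ep x ^ n"
  by (induction n) (simp_all add: ep_add algebra_simps)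

lemma Re_ep: "Re (ep x) = cos (2 * pi * x)"
  by (simp add: ep_def)

text \<open>Since \<open>cmod (ep x - 1)\<close> equals 2 |sin (\<pi> x)|, it is enough that |sin y|
  \<ge> |y| / 2 for |y| \<le> 1.6. This follows from the cubic Taylor bound, because 1.6^2 / 6 <
  1/2.\<close>

lemma norm_ep_minus_1_ge:
  assumes "\<bar>x\<bar> \<le> 1/2"
  shows "\<bar>x\<bar> \<le> cmod (ep x - 1)"
proof -
  define y where "y = pi * x"
  have y: "\<bar>y\<bar> \<le> 1.6" 
  proof -
    have "\<bar>y\<bar> = pi * \<bar>x\<bar>" by (simp add: y_def abs_mult)
    also have "\<dots> \<le> 3.2 * (1/2)"
      using assms pi_approx by (intro mult_mono) auto
    finally show ?thesis by simp
  qed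
  have "\<bar>sin y - (\<Sum>m<3. sin_coeff m * y ^ m)\<bar> \<le> inverse (fact 3) * \<bar>y\<bar> ^ 3"
    by (rule Maclaurin_sin_bound)
  then have "\<bar>sin y - y\<bar> \<le> \<bar>y\<bar> ^ 3 / 6"
    by (simp add: sin_coeff_def numeral_3_eq_3 fact_numeral)
  moreover have "\<bar>y\<bar> ^ 3 / 6 \<le> \<bar>y\<bar> / 2"
  proof -
    have "\<bar>y\<bar> ^ 3 = \<bar>y\<bar> * \<bar>y\<bar>^2" by (simp add: power3_eq_cube power2_eq_square)
    also have "\<dots> \<le> \<bar>y\<bar> * 1.6^2"
      using y by (intro mult_left_mono power_mono) auto
    finally show ?thesis by (simp add: power2_eq_square)
  qed
  ultimately have 1: "\<bar>y\<bar> \<le> 2 * \<bar>sin y\<bar>" by linarith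
  have "cmod (ep x - 1) ^ 2 = (cos (2*y) - 1)^2 + (sin (2*y))^2"
    by (simp add: ep_def cmod_power2 y_def mult.assoc)
  also have "\<dots> = (sin (2*y))^2 + (cos (2*y))^2 + 1 - 2 * cos (2*y)"
    by (simp add: power2_eq_square algebra_simps)
  also have "\<dots> = 2 - 2 * cos (2*y)"
    by simp
  also have "\<dots> = (2 * \<bar>sin y\<bar>)^2"
    by (simp add: cos_double_sin power_mult_distrib)
  finally have "cmod (ep x - 1) = 2 * \<bar>sin y\<bar>"
    by (rule power2_eq_imp_eq) auto
  moreover have "\<bar>x\<bar> \<le> \<bar>y\<bar>"
    using pi_ge_two by (simp add: y_def abs_mult mult_le_cancel_right1)
  ultimately show ?thesis using 1 by linarith
qed

lemma near_int_mono: "near_int \<eta> x \<Longrightarrow> \<eta> \<le> \<eta>' \<Longrightarrow> near_int \<eta>' x"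
  unfolding near_int_def by (meson order_trans)

lemma near_int_half: "near_int (1/2) x"
  unfolding near_int_def using of_int_round_abs_le[of x]
  by (metis abs_minus_commute)

lemma near_int_add:
  assumes "near_int \<eta> x" "near_int \<eta>' y"
  shows "near_int (\<eta> + \<eta>') (x + y)"
proof -
  obtain z w :: int where "\<bar>x - z\<bar> \<le> \<eta>" "\<bar>y - w\<bar> \<le> \<eta>'"
    using assms unfolding near_int_def by auto
  then have "\<bar>(x + y) - of_int (z + w)\<bar> \<le> \<eta> + \<eta>'" by simp
  then show ?thesis unfolding near_int_def by blast
qed

lemma near_int_mult:
  assumes "near_int \<eta> x" "\<bar>of_int c\<bar> \<le> (B::real)"
  shows "near_int (B * \<eta>) (of_int c * x)"
proof -
  obtain z :: int where z: "\<bar>x - z\<bar> \<le> \<eta>"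
    using assms unfolding near_int_def by auto
  have "\<bar>of_int c * x - of_int (c * z)\<bar> = \<bar>of_int c\<bar> * \<bar>x - z\<bar>"
    by (simp add: abs_mult[symmetric] algebra_simps)
  also have "\<dots> \<le> B * \<eta>"
    using assms(2) z by (intro mult_mono) auto
  finally show ?thesis unfolding near_int_def by blast
qed

lemma near_int_diff:
  assumes "near_int \<eta> x" "near_int \<eta>' y"
  shows "near_int (\<eta> + \<eta>') (x - y)"
  using near_int_add[OF assms(1) near_int_mult[OF assms(2), of "-1" 1]] by simp

section \<open>Polynomial sequences and their highest differences\<close>

text \<open>
  The sequence \<open>p\<close> is polynomial of degree at most \<open>d\<close>; the parameter \<open>\<alpha>\<close> is its \<open>d\<close>-th difference,
  that is, \<open>fact d\<close> times the coefficient of degree \<open>d\<close>.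
\<close>
fun polyseq :: "nat \<Rightarrow> real \<Rightarrow> (int \<Rightarrow> real) \<Rightarrow> bool" where
  "polyseq 0 \<alpha> p \<longleftrightarrow> (\<forall>n. p n = \<alpha>)"
| "polyseq (Suc d) \<alpha> p \<longleftrightarrow> (\<forall>h. polyseq d (of_int h * \<alpha>) (\<lambda>n. p (n + h) - p n))"

lemma polyseq_cmult: "polyseq d \<alpha> p \<Longrightarrow> polyseq d (c * \<alpha>) (\<lambda>n. c * p n)"
proof (induction d arbitrary: \<alpha> p)
  case (Suc d)
  have "polyseq d (of_int h * (c * \<alpha>)) (\<lambda>n. c * p (n + h) - c * p n)" for h
  proof -
    have "polyseq d (of_int h * \<alpha>) (\<lambda>n. p (n + h) - p n)" using Suc.prems by simp
    from Suc.IH[OF this] show ?thesis by (simp add: algebra_simps)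
  qed
  then show ?case by simp
qed simp

lemma polyseq_add: "polyseq d \<alpha> p \<Longrightarrow> polyseq d \<beta> q \<Longrightarrow> polyseq d (\<alpha> + \<beta>) (\<lambda>n. p n + q n)"
proof (induction d arbitrary: \<alpha> p \<beta> q)
  case (Suc d)
  have "polyseq d (of_int h * (\<alpha> + \<beta>)) (\<lambda>n. (p (n + h) + q (n + h)) - (p n + q n))" for h
  proof -
    have "polyseq d (of_int h * \<alpha> + of_int h * \<beta>)
        (\<lambda>n. (p (n + h) - p n) + (q (n + h) - q n))"
      using Suc.prems by (intro Suc.IH) auto
    then show ?thesis by (simp add: algebra_simps)
  qed
  then show ?case by simp
qed simp

lemma polyseq_shift: "polyseq d \<alpha> p \<Longrightarrow> polyseq d \<alpha> (\<lambda>n. p (n + k))"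
proof (induction d arbitrary: \<alpha> p)
  case (Suc d)
  have "polyseq d (of_int h * \<alpha>) (\<lambda>n. p (n + h + k) - p (n + k))" for h
  proof -
    have "polyseq d (of_int h * \<alpha>) (\<lambda>n. p (n + h) - p n)" using Suc.prems by simp
    from Suc.IH[OF this] show ?thesis by (simp add: ac_simps)
  qed
  then show ?case by simp
qed simp

lemma polyseq_lift: "polyseq d \<alpha> p \<Longrightarrow> polyseq (Suc d) 0 p"
proof (induction d arbitrary: \<alpha> p)
  case (Suc d)
  have "polyseq (Suc d) 0 (\<lambda>n. p (n + h) - p n)" for h
    using Suc.prems by (intro Suc.IH[of "of_int h * \<alpha>"]) simp
  then show ?case by (subst polyseq.simps) simp
qed simp

text \<open>Discrete product rule: the \<open>h\<close>-difference of \<open>n * p n\<close> is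
  \<open>n\<close> times the \<open>h\<close>-difference of \<open>p\<close>, plus
  \<open>h * p (n + h)\<close>. In the induction step the first term contributes
  \<open>Suc d * h * \<alpha>\<close> and the second one more \<open>h * \<alpha>\<close>.\<close>

lemma polyseq_times: "polyseq d \<alpha> p \<Longrightarrow> polyseq (Suc d) (of_nat (Suc d) * \<alpha>) (\<lambda>n. of_int n * p n)"
proof (induction d arbitrary: \<alpha> p)
  case 0
  then show ?case by (simp add: algebra_simps)
next
  case (Suc d)
  have "polyseq (Suc d) (of_int h * (of_nat (Suc (Suc d)) * \<alpha>))
      (\<lambda>n. of_int (n + h) * p (n + h) - of_int n * p n)" for h
  proof -
    have 1: "polyseq (Suc d) (of_nat (Suc d) * (of_int h * \<alpha>)) (\<lambda>n. of_int n * (p (n + h) - p n))"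
      using Suc.prems by (intro Suc.IH) simp
    have 2: "polyseq (Suc d) (of_int h * \<alpha>) (\<lambda>n. of_int h * p (n + h))"
      by (intro polyseq_cmult polyseq_shift Suc.prems)
    have "of_nat (Suc d) * (of_int h * \<alpha>) + of_int h * \<alpha> = of_int h * (of_nat (Suc (Suc d)) * \<alpha>)"
      by (simp add: algebra_simps)
    moreover have "(\<lambda>n. of_int n * (p (n + h) - p n) + of_int h * p (n + h)) =
        (\<lambda>n. of_int (n + h) * p (n + h) - of_int n * p n)"
      by (simp add: algebra_simps)
    ultimately show ?thesis
      using polyseq_add[OF 1 2] by metis
  qed
  then show ?case by (subst polyseq.simps) blast
qed

text \<open>Horner induction: \<open>pCons a f\<close> takes the value \<open>a + n * f n\<close>,
  so \<open>polyseq_times\<close> raises the degree and builds up the factorial.\<close>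

lemma polyseq_poly:
  "degree f \<le> d \<Longrightarrow> polyseq d (fact d * of_int (coeff f d)) (\<lambda>n. of_int (poly f n))"
proof (induction f arbitrary: d)
  case 0
  have "polyseq d 0 (\<lambda>n. 0)" for d by (induction d) auto
  then show ?case by simp
next
  case (pCons a f)
  show ?case
  proof (cases d)
    case 0
    then show ?thesis using pCons by (auto split: if_splits)
  next
    case (Suc e)
    have c: "polyseq d 0 (\<lambda>n. of_int a)"
    proof -
      have "polyseq (Suc k) 0 (\<lambda>n. of_int a)" for k
      proof (induction k)
        case (Suc k) then show ?case by (rule polyseq_lift)
      qed auto
      then show ?thesis using Suc by blast
    qed
    have "degree f \<le> e" using pCons.prems Suc by (auto split: if_splits)
    then have "polyseq e (fact e * of_int (coeff f e)) (\<lambda>n. of_int (poly f n))"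
      by (rule pCons.IH)
    from polyseq_add[OF c polyseq_times[OF this, folded Suc]]
    show ?thesis using Suc by (simp add: mult.assoc)
  qed
qed

lemma pigeonhole_fibre:
  fixes g :: "'a \<Rightarrow> 'b"
  assumes "finite A" "g ` A \<subseteq> B" "finite B" "card B \<le> m" "x * real m \<le> real (card A)" "A \<noteq> {}"
  shows "\<exists>b\<in>B. x \<le> real (card {a\<in>A. g a = b})"
proof -
  have "B \<noteq> {}" using assms by auto
  from pigeonhole_card[of g A B] assms this
  obtain b where b: "b \<in> B" "card (g -` {b} \<inter> A) * card B \<ge> card A" by auto
  have eq: "g -` {b} \<inter> A = {a\<in>A. g a = b}" by auto
  have "card B > 0" using \<open>B \<noteq> {}\<close> assms by (simp add: card_gt_0_iff)
  then have m: "real m > 0" using assms by linarith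
  have "x * m \<le> card (g -` {b} \<inter> A) * real (card B)"
    using b(2) assms(5) by (metis of_nat_le_iff of_nat_mult order_trans)
  also have "\<dots> \<le> card (g -` {b} \<inter> A) * real m"
    using assms(4) by (intro mult_left_mono) auto
  finally show ?thesis using m b(1) unfolding eq by auto
qed

subsection \<open>The inverse theorem for Weyl sums\<close>

lemma near_int_of_many_multiples:
  fixes \<delta> K :: real
  assumes \<delta>: "\<delta> > 0" and K: "K > 0" and d: "d \<ge> 1"
  shows "\<exists>K'::nat. K' \<ge> 1 \<and> (\<forall>(N::nat) H \<beta>. N \<ge> 1 \<longrightarrow> H \<subseteq> {-int N<..<int N} \<longrightarrow>
      \<delta> * real N \<le> real (card H) \<longrightarrow> (\<forall>h\<in>H. near_int (K / real N ^ d) (of_int h * \<beta>)) \<longrightarrow>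
      (\<exists>q\<in>{1..K'}. near_int (real K' / real N ^ Suc d) (real q * \<beta>)))"
proof -
  \<comment> \<open>\<open>G\<close> bounds the difference \<open>q0\<close> of two elements of \<open>H\<close>. Two further elements, congruent modulo
    \<open>q0\<close> and far apart but within \<open>N / c\<close>, improve the error for \<open>q0 * \<beta>\<close> by a factor \<open>N\<close>; the
    short range \<open>N / c\<close> prevents the multiple of the error from wrapping around modulo 1.\<close>
  obtain c :: nat where c: "8 * K + 1 \<le> real c" using real_arch_simple by blast
  obtain G :: nat where G: "8 / \<delta> + 1 \<le> real G" using real_arch_simple by blast
  have c1: "real c \<ge> 1" using c K by linarith
  have G1: "real G \<ge> 1" using G \<delta> by (smt (verit) divide_pos_pos)
  then have Gpos: "G > 0" by linarith
  \<comment> \<open>From \<open>N0\<close> on, the three bounds give \<kappa> \<le> 1/8, a collision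
    in blocks of length \<open>G\<close>, and \<open>s \<ge> 2\<close>. Below \<open>N0\<close> the
    tolerance exceeds 1/2, because \<open>K'\<close> is at least \<open>N0 ^ Suc d\<close>, and then
    \<open>q = 1\<close> works.\<close>
  obtain N0 :: nat where N0: "max (8 * K) (max (9 / \<delta>) (6 * c * G / \<delta>)) \<le> real N0" 
    using real_arch_simple by blast
  obtain K' :: nat where K': "max (12 * K * c * G^2 / \<delta>) (max G (max 1 (real N0 ^ Suc d))) \<le> real K'" 
    using real_arch_simple by blast
  have "\<exists>q\<in>{1..K'}. near_int (real K' / real N ^ Suc d) (real q * \<beta>)"
    if N: "N \<ge> 1" and H: "H \<subseteq> {-int N<..<int N}" "\<delta> * real N \<le> real (card H)"
      and near: "\<forall>h\<in>H. near_int (K / real N ^ d) (of_int h * \<beta>)" for N :: nat and H \<beta>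
  proof (cases "N \<ge> N0")
    case False
    then have "real N ^ Suc d \<le> real N0 ^ Suc d" by (intro power_mono) auto
    then have "1/2 \<le> real K' / real N ^ Suc d"
      using K' N by (simp add: field_simps)
    then have "near_int (real K' / real N ^ Suc d) (real 1 * \<beta>)"
      using near_int_half near_int_mono by blast
    moreover have "1 \<in> {1..K'}" using K' by auto
    ultimately show ?thesis by blast
  next
    case True
    have N8: "8 * K \<le> real N" "9 / \<delta> \<le> real N" "6 * c * G / \<delta> \<le> real N" using N0 True by auto
    have finH: "finite H" using H finite_subset by blast
    define \<kappa> where "\<kappa> = K / real N ^ d"
    have diff: "near_int (2 * \<kappa>) (of_int (h - h') * \<beta>)" if "h \<in> H" "h' \<in> H" for h h'
      using near_int_diff[of \<kappa> "of_int h * \<beta>" \<kappa> "of_int h' * \<beta>"] near that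
      by (simp add: \<kappa>_def algebra_simps)
    have \<kappa>: "\<kappa> \<le> K / real N"
    proof -
      have "real N ^ 1 \<le> real N ^ d" using N d by (intro power_increasing) auto
      then show ?thesis unfolding \<kappa>_def using K N by (intro divide_left_mono) auto
    qed
    have \<kappa>8: "\<kappa> \<le> 1/8"
    proof -
      have "K / real N \<le> 1/8" using N8(1) N by (simp add: field_simps)
      with \<kappa> show ?thesis by linarith
    qed
    \<comment> \<open>Only \<open>2 * (N div G) + 2\<close> blocks of length \<open>G\<close> meet
      the range of \<open>H\<close>, fewer than its \<delta> N elements. Two elements in one block
      differ by less than \<open>G\<close>.\<close>
    have "\<not> inj_on (\<lambda>h. h div int G) H"
    proof
      assume "inj_on (\<lambda>h. h div int G) H"
      then have "card H = card ((\<lambda>h. h div int G) ` H)" by (simp add: card_image)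
      also have "\<dots> \<le> card {-(int N div int G) - 1..int N div int G}"
      proof (rule card_mono)
        show "(\<lambda>h. h div int G) ` H \<subseteq> {-(int N div int G) - 1..int N div int G}"
        proof safe
          fix h assume "h \<in> H"
          then have h: "-int N \<le> h" "h \<le> int N" using H by auto
          have "h div int G \<le> int N div int G" using h Gpos by (intro zdiv_mono1) auto
          moreover have "(-int N) div int G \<le> h div int G" using h Gpos by (intro zdiv_mono1) auto
          moreover have "- (int N div int G) - 1 \<le> (-int N) div int G"
            by (simp add: zdiv_zminus1_eq_if Gpos)
          ultimately show "h div int G \<in> {-(int N div int G) - 1..int N div int G}" by auto
        qed
      qed auto
      also have "\<dots> = 2 * (N div G) + 2"
        by (simp add: zdiv_int[symmetric] nat_eq_iff)
      finally have "real (card H) \<le> 2 * real (N div G) + 2" by linarith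
      also have "real (N div G) \<le> real N / real G" by (rule of_nat_div_le_of_nat)
      also have "real N / real G \<le> \<delta> * N / 8"
      proof -
        have "8 / \<delta> \<le> real G" using G by linarith
        then have "8 \<le> \<delta> * real G" using \<delta> by (simp add: field_simps)
        then have "real N * 8 \<le> real N * (\<delta> * real G)" by (intro mult_left_mono) auto
        then show ?thesis using G1 by (simp add: field_simps)
      qed
      finally have "real (card H) \<le> \<delta> * N / 4 + 2" by simp
      moreover have "9 \<le> \<delta> * N" using N8(2) \<delta> by (simp add: field_simps)
      ultimately show False using H(2) by linarith
    qed
    then obtain h h' where hh: "h \<in> H" "h' \<in> H" "h' < h" "h div int G = h' div int G"
      unfolding inj_on_def by (metis linorder_neqE)
    define q0 where "q0 = nat (h - h')"
    have q0: "int q0 = h - h'" "q0 \<ge> 1" using hh by (auto simp: q0_def)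
    have q0G: "q0 \<le> G"
    proof -
      have "h = int G * (h div int G) + h mod int G" "h' = int G * (h' div int G) + h' mod int G" by simp_all
      moreover have "h mod int G < int G" "h' mod int G \<ge> 0" using Gpos by auto
      ultimately have "h - h' < int G" using hh(4) by (smt (verit))
      then show ?thesis using q0 by linarith
    qed
    have "near_int (2 * \<kappa>) (real q0 * \<beta>)"
      using diff[OF hh(1,2)] q0(1) by (metis of_int_of_nat_eq)
    then obtain m :: int where m: "\<bar>real q0 * \<beta> - of_int m\<bar> \<le> 2 * \<kappa>"
      unfolding near_int_def by blast
    define \<eta> where "\<eta> = real q0 * \<beta> - of_int m"
    \<comment> \<open>There are at most \<open>3 * c * G\<close> pairs of a block of length
      \<open>N / c\<close> and a residue modulo \<open>q0\<close>, so some pair collects at least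
      \<open>s\<close> elements of \<open>H\<close>. Its extreme elements are then at least
      \<open>s / 2\<close> apart.\<close>
    define s where "s = \<delta> * N / (3 * c * G)"
    have s2: "s \<ge> 2" unfolding s_def using N8(3) \<delta> c1 G1 by (simp add: field_simps)
    define g where "g = (\<lambda>h. ((h * int c) div int N, h mod int q0))"
    have "\<exists>b\<in>{-int c..int c} \<times> {0..<int q0}. s \<le> real (card {h\<in>H. g h = b})"
    proof (rule pigeonhole_fibre)
      show "g ` H \<subseteq> {-int c..int c} \<times> {0..<int q0}"
      proof (clarsimp simp: g_def)
        fix h assume "h \<in> H"
        then have h: "-int N \<le> h" "h \<le> int N" using H by auto
        have "(h * int c) div int N \<le> (int N * int c) div int N"
          using h N by (intro zdiv_mono1 mult_right_mono) auto
        moreover have "(-int N * int c) div int N \<le> (h * int c) div int N"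
          using h N by (intro zdiv_mono1 mult_right_mono) auto
        moreover have "(-int N * int c) div int N = - int c"
        proof -
          have "-int N * int c = int N * (- int c)" by simp
          then show ?thesis using N by (metis nonzero_mult_div_cancel_left of_nat_0_eq_iff not_one_le_zero)
        qed
        ultimately show "- int c \<le> h * int c div int N \<and> h * int c div int N \<le> int c \<and>
            0 \<le> h mod int q0 \<and> h mod int q0 < int q0"
          using N q0 by auto
      qed
      have "card ({-int c..int c} \<times> {0..<int q0}) = (2 * c + 1) * q0"
        by (simp add: card_cartesian_product nat_add_distrib nat_mult_distrib)
      also have "\<dots> \<le> (3 * c) * G" using c1 q0G by (intro mult_le_mono) auto
      finally show "card ({-int c..int c} \<times> {0..<int q0}) \<le> 3 * c * G" by simp
      show "s * real (3 * c * G) \<le> real (card H)"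
        using H(2) c1 G1 by (simp add: s_def)
      show "H \<noteq> {}" using hh by auto
    qed (use finH in auto)
    then obtain b where b: "s \<le> real (card {h\<in>H. g h = b})" by blast
    define H' where "H' = {h\<in>H. g h = b}"
    have finH': "finite H'" using finH by (simp add: H'_def)
    have H'ne: "H' \<noteq> {}" using b s2 unfolding H'_def by fastforce
    define h1 where "h1 = Min H'"
    define h2 where "h2 = Max H'"
    have h12: "h1 \<in> H'" "h2 \<in> H'" using finH' H'ne by (auto simp: h1_def h2_def)
    have "H' \<subseteq> {h1..h2}" using finH' by (auto simp: h1_def h2_def)
    then have "card H' \<le> card {h1..h2}" by (intro card_mono) auto
    moreover have le12: "h1 \<le> h2" using finH' H'ne h12 by (simp add: h1_def)
    ultimately have "real (card H') \<le> of_int (h2 - h1) + 1" by simp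
    then have s_le: "s / 2 \<le> of_int (h2 - h1)" using b s2 unfolding H'_def by linarith
    have geq: "g h1 = g h2" using h12 by (auto simp: H'_def)
    then have "h2 mod int q0 = h1 mod int q0" by (simp add: g_def)
    then have "int q0 dvd h2 - h1" by (simp add: mod_eq_dvd_iff)
    then obtain t where t: "h2 - h1 = int q0 * t" by (auto elim: dvdE)
    have tpos: "t > 0"
    proof -
      have "h2 - h1 > 0" using s_le s2 by linarith
      then show ?thesis using t q0(2) by (simp add: zero_less_mult_iff)
    qed
    have width: "of_int (h2 - h1) * real c \<le> real N"
    proof -
      have "(h1 * int c) div int N = (h2 * int c) div int N" using geq by (simp add: g_def)
      moreover have "h2 * int c = int N * (h2 * int c div int N) + h2 * int c mod int N" 
        "h1 * int c = int N * (h1 * int c div int N) + h1 * int c mod int N" by simp_all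
      moreover have "h2 * int c mod int N < int N" "h1 * int c mod int N \<ge> 0" using N by auto
      ultimately have "h2 * int c - h1 * int c \<le> int N" by (smt (verit))
      then have "(h2 - h1) * int c \<le> int N" by (simp add: algebra_simps)
      then show ?thesis by (metis of_int_le_iff of_int_mult of_int_of_nat_eq)
    qed
    have tc: "of_int t * real c \<le> real N"
    proof -
      have "1 * t \<le> int q0 * t" using q0 tpos by (intro mult_right_mono) auto
      then have "of_int t \<le> (of_int (h2 - h1) :: real)" using t by (simp only: of_int_le_iff mult_1)
      then have "of_int t * real c \<le> of_int (h2 - h1) * real c" by (intro mult_right_mono) auto
      with width show ?thesis by linarith
    qed
    have \<eta>2: "\<bar>\<eta>\<bar> \<le> 2 * \<kappa>" using m by (simp add: \<eta>_def)
    have t\<eta>: "\<bar>of_int t * \<eta>\<bar> \<le> 1/4"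
    proof -
      have "\<bar>of_int t * \<eta>\<bar> = of_int t * \<bar>\<eta>\<bar>" using tpos by (simp add: abs_mult)
      also have "\<dots> \<le> (real N / c) * (2 * (K / N))"
      proof (rule mult_mono)
        show "of_int t \<le> real N / real c" using tc c1 by (simp add: field_simps)
        show "\<bar>\<eta>\<bar> \<le> 2 * (K / N)" using \<eta>2 \<kappa> by linarith
      qed auto
      also have "\<dots> = 2 * K / c" using N by simp
      also have "\<dots> \<le> 1/4" using c c1 by (simp add: field_simps)
      finally show ?thesis .
    qed
    have "near_int (2 * \<kappa>) (of_int (h2 - h1) * \<beta>)"
      using diff h12 by (auto simp: H'_def)
    then obtain z :: int where z: "\<bar>of_int (h2 - h1) * \<beta> - of_int z\<bar> \<le> 2 * \<kappa>"
      unfolding near_int_def by blast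
    \<comment> \<open>The multiple of \<beta> lies within 1/4 of \<open>z\<close> and, by this
      identity, within 1/4 of \<open>t * m\<close>, so the two integers agree. Hence
      \<open>t * \<eta>\<close> itself, not only its residue modulo 1, is at most 2 \<kappa>; as
      \<open>t\<close> has order \<open>N\<close>, this is the gain.\<close>
    have eq: "of_int (h2 - h1) * \<beta> = of_int t * \<eta> + of_int (t * m)"
      by (simp add: t \<eta>_def algebra_simps)
    have "\<bar>of_int (t * m - z) :: real\<bar> \<le> 1/4 + 1/4"
      using z eq t\<eta> \<kappa>8 by (simp only: of_int_diff)
    then have "t * m - z = 0" by linarith
    then have "\<bar>of_int t * \<eta>\<bar> \<le> 2 * \<kappa>" using z eq by auto
    then have "of_int t * \<bar>\<eta>\<bar> \<le> 2 * \<kappa>" using tpos by (simp add: abs_mult)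
    moreover have "s / (2 * G) \<le> of_int t"
    proof -
      have "s / 2 \<le> real q0 * of_int t" using s_le t by simp
      also have "\<dots> \<le> real G * of_int t" using q0G tpos by (intro mult_right_mono) auto
      finally show ?thesis using G1 by (simp add: field_simps)
    qed
    ultimately have "s / (2 * G) * \<bar>\<eta>\<bar> \<le> 2 * \<kappa>"
      by (meson abs_ge_zero mult_right_mono order_trans)
    then have "\<bar>\<eta>\<bar> \<le> 4 * \<kappa> * G / s" using s2 G1 by (simp add: field_simps)
    also have "\<dots> = (12 * K * c * G^2 / \<delta>) / real N ^ Suc d"
      using N \<delta> c1 G1 by (simp add: s_def \<kappa>_def field_simps power2_eq_square)
    also have "\<dots> \<le> real K' / real N ^ Suc d"
      using K' by (intro divide_right_mono) auto
    finally have "near_int (real K' / real N ^ Suc d) (real q0 * \<beta>)"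
      unfolding near_int_def \<eta>_def by blast
    moreover have "q0 \<in> {1..K'}" using q0 q0G K' by auto
    ultimately show ?thesis by blast
  qed
  moreover have "K' \<ge> 1" using K' by auto
  ultimately show ?thesis by blast
qed

lemma norm_sum_ep_le: "cmod (\<Sum>n\<in>A. ep (p n)) \<le> real (card A)"
  by (rule order_trans[OF norm_sum]) simp

text \<open>Expand the square into a double sum over \<open>m\<close> and \<open>n\<close> and put
  \<open>m = n + h\<close>. For fixed \<open>h\<close> the admissible \<open>n\<close> again form an
  interval, so the step can be iterated.\<close>

lemma weyl_differencing:
  fixes p :: "int \<Rightarrow> real"
  assumes "b - a \<le> int N"
  shows "(cmod (\<Sum>n\<in>{a..<b}. ep (p n)))\<^sup>2 \<le>
    (\<Sum>h\<in>{-int N<..<int N}. cmod (\<Sum>n\<in>{max a (a-h)..<min b (b-h)}. ep (p (n + h) - p n)))"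
proof -
  let ?I = "{a..<b}" and ?H = "{-int N<..<int N}"
  define S where "S = (\<Sum>n\<in>?I. ep (p n))"
  have "S * cnj S = (\<Sum>m\<in>?I. \<Sum>n\<in>?I. ep (p m - p n))"
    by (simp add: S_def sum_product ep_diff)
  also have "\<dots> = (\<Sum>(m,n)\<in>?I \<times> ?I. ep (p m - p n))"
    by (simp add: sum.cartesian_product)
  also have "\<dots> = (\<Sum>(h,n)\<in>(SIGMA h:?H. {max a (a-h)..<min b (b-h)}). ep (p (n + h) - p n))"
    by (rule sum.reindex_bij_witness[of _ "\<lambda>(h,n). (n + h, n)" "\<lambda>(m,n). (m - n, n)"])
      (use assms in auto)
  also have "\<dots> = (\<Sum>h\<in>?H. \<Sum>n\<in>{max a (a-h)..<min b (b-h)}. ep (p (n + h) - p n))"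
    by (simp add: sum.Sigma)
  finally have eq: "S * cnj S = (\<Sum>h\<in>?H. \<Sum>n\<in>{max a (a-h)..<min b (b-h)}. ep (p (n + h) - p n))" .
  have "cmod (S * cnj S) \<le> (\<Sum>h\<in>?H. cmod (\<Sum>n\<in>{max a (a-h)..<min b (b-h)}. ep (p (n + h) - p n)))"
    unfolding eq by (rule norm_sum)
  moreover have "cmod (S * cnj S) = (cmod S)\<^sup>2"
    by (simp add: norm_mult power2_eq_square)
  ultimately show ?thesis by (simp add: S_def)
qed

text \<open>A geometric sum: multiplying it by \<open>ep \<alpha> - 1\<close> telescopes, so the
  product has norm at most 2, while \<open>ep \<alpha> - 1\<close> is at least the distance of
  \<alpha> to the integers.\<close>

lemma weyl_inverse_linear:
  assumes p: "polyseq 1 \<alpha> p" and "b - a \<le> int N" and N: "N \<ge> 1" and \<delta>: "\<delta> > 0"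
    and big: "\<delta> * real N \<le> cmod (\<Sum>n\<in>{a..<b}. ep (p n))"
  shows "near_int (2 / (\<delta> * real N)) \<alpha>"
proof -
  define z where "z = round \<alpha>"
  have z: "\<bar>\<alpha> - of_int z\<bar> \<le> 1/2"
    using of_int_round_abs_le[of \<alpha>] by (simp add: z_def abs_minus_commute)
  have ab: "a \<le> b"
  proof (rule ccontr)
    assume "\<not> a \<le> b"
    then have "\<delta> * real N \<le> 0" using big by simp
    then show False using \<delta> N by (simp add: mult_le_0_iff)
  qed
  have step: "p (n + 1) = p n + \<alpha>" for n
  proof -
    have "p (n + 1) - p n = of_int 1 * \<alpha>"
      using p unfolding One_nat_def polyseq.simps by blast
    then show ?thesis by simp
  qed
  have "(ep \<alpha> - 1) * (\<Sum>n\<in>{a..<a + int k}. ep (p n)) = ep (p (a + int k)) - ep (p a)" for k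
  proof (induction k)
    case (Suc k)
    have "{a..<a + int (Suc k)} = insert (a + int k) {a..<a + int k}" by auto
    then have "(ep \<alpha> - 1) * (\<Sum>n\<in>{a..<a + int (Suc k)}. ep (p n)) =
        (ep \<alpha> - 1) * ep (p (a + int k)) + (ep (p (a + int k)) - ep (p a))"
      using Suc by (simp add: distrib_left)
    also have "\<dots> = ep (p (a + int k + 1)) - ep (p a)"
      unfolding step by (simp add: ep_add algebra_simps)
    finally show ?case by (simp add: ac_simps)
  qed simp
  from this[of "nat (b - a)"]
  have "(ep \<alpha> - 1) * (\<Sum>n\<in>{a..<b}. ep (p n)) = ep (p b) - ep (p a)"
    using ab by simp
  then have "cmod (ep \<alpha> - 1) * cmod (\<Sum>n\<in>{a..<b}. ep (p n)) \<le> 2"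
    using norm_triangle_ineq4[of "ep (p b)" "ep (p a)"] by (simp flip: norm_mult)
  moreover have "\<bar>\<alpha> - of_int z\<bar> * (\<delta> * real N) \<le> cmod (ep \<alpha> - 1) * cmod (\<Sum>n\<in>{a..<b}. ep (p n))"
  proof (rule mult_mono[OF _ big])
    have "ep (\<alpha> - of_int z) = ep \<alpha>" by (simp add: ep_diff)
    then show "\<bar>\<alpha> - of_int z\<bar> \<le> cmod (ep \<alpha> - 1)"
      using norm_ep_minus_1_ge[OF z] by simp
  qed (use \<delta> in auto)
  ultimately have "\<bar>\<alpha> - of_int z\<bar> \<le> 2 / (\<delta> * real N)"
    using \<delta> N by (simp add: pos_le_divide_eq)
  then show ?thesis unfolding near_int_def by blast
qed

text \<open>Induction on the degree. If the sum is large, many of its differenced sums are large,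
  and the induction hypothesis gives each such \<open>h * \<alpha>\<close> a small denominator;
  \<open>near_int_of_many_multiples\<close> removes \<open>h\<close> and gains the missing factor
  \<open>N\<close>. Arbitrary intervals of length at most \<open>N\<close> are allowed because
  differencing shortens the interval while the scale stays \<open>N\<close>.\<close>

lemma weyl_inverse_polyseq:
  fixes \<delta> :: real
  assumes "\<delta> > 0"
  shows "\<exists>K::nat. K \<ge> 1 \<and> (\<forall>(N::nat) a b p \<alpha>. N \<ge> 1 \<longrightarrow> b - a \<le> int N \<longrightarrow> polyseq (Suc d) \<alpha> p \<longrightarrow>
      \<delta> * real N \<le> cmod (\<Sum>n\<in>{a..<b}. ep (p n)) \<longrightarrow>
      (\<exists>q\<in>{1..K}. near_int (real K / real N ^ Suc d) (real q * \<alpha>)))"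
  using assms
proof (induction d arbitrary: \<delta>)
  case 0
  obtain K :: nat where K: "max 1 (2 / \<delta>) \<le> real K" using real_arch_simple by blast
  show ?case
  proof (intro exI[of _ K] conjI allI impI)
    fix N :: nat and a b p \<alpha>
    assume *: "N \<ge> 1" "b - a \<le> int N" "polyseq (Suc 0) \<alpha> p"
      "\<delta> * real N \<le> cmod (\<Sum>n\<in>{a..<b}. ep (p n))"
    have "2 / (\<delta> * real N) \<le> real K / real N"
      using K * 0 by (simp add: field_simps)
    with weyl_inverse_linear[of \<alpha> p b a N \<delta>] * 0
    have "near_int (real K / real N ^ Suc 0) (real 1 * \<alpha>)"
      using near_int_mono by simp
    moreover have "1 \<in> {1..K}" using K by auto
    ultimately show "\<exists>q\<in>{1..K}. near_int (real K / real N ^ Suc 0) (real q * \<alpha>)" by blast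
  qed (use K in auto)
next
  case (Suc d)
  have "\<delta>\<^sup>2 / 4 > 0" using Suc.prems by simp
  from Suc.IH[OF this] obtain K :: nat where K1: "K \<ge> 1" and
    K: "\<And>(N::nat) a b p \<alpha>. N \<ge> 1 \<Longrightarrow> b - a \<le> int N \<Longrightarrow> polyseq (Suc d) \<alpha> p \<Longrightarrow>
      \<delta>\<^sup>2 / 4 * real N \<le> cmod (\<Sum>n\<in>{a..<b}. ep (p n)) \<Longrightarrow>
      \<exists>q\<in>{1..K}. near_int (real K / real N ^ Suc d) (real q * \<alpha>)" by blast
  have "\<delta>\<^sup>2 / (2 * real K) > 0" "real K > 0" "Suc d \<ge> 1" using Suc.prems K1 by auto
  from near_int_of_many_multiples[OF this] obtain K' :: nat where K'1: "K' \<ge> 1" and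
    K': "\<And>(N::nat) H \<beta>. N \<ge> 1 \<Longrightarrow> H \<subseteq> {-int N<..<int N} \<Longrightarrow>
      \<delta>\<^sup>2 / (2 * real K) * real N \<le> real (card H) \<Longrightarrow> \<forall>h\<in>H. near_int (real K / real N ^ Suc d) (of_int h * \<beta>) \<Longrightarrow>
      \<exists>q\<in>{1..K'}. near_int (real K' / real N ^ Suc (Suc d)) (real q * \<beta>)" by blast
  show ?case
  proof (intro exI[of _ "K' * K"] conjI allI impI)
    fix N :: nat and a b p \<alpha>
    assume N: "N \<ge> 1" and ab: "b - a \<le> int N" and p: "polyseq (Suc (Suc d)) \<alpha> p" and
      big: "\<delta> * real N \<le> cmod (\<Sum>n\<in>{a..<b}. ep (p n))"
    define S where "S = (\<lambda>h. \<Sum>n\<in>{max a (a-h)..<min b (b-h)}. ep (p (n + h) - p n))"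
    define HH where "HH = {-int N<..<int N}"
    \<comment> \<open>There are fewer than \<open>2 * N\<close> shifts, so those below this
      threshold contribute at most half of (\<delta> N)^2. The other half forces \<open>H\<close> to
      be a positive proportion of the shifts.\<close>
    define H where "H = {h\<in>HH. \<delta>\<^sup>2 / 4 * real N \<le> cmod (S h)}"
    have finHH: "finite HH" by (simp add: HH_def)
    then have fin: "finite HH" "finite H" by (auto simp: H_def)
    have cardHH: "real (card HH) \<le> 2 * real N" using N by (simp add: HH_def)
    have SN: "cmod (S h) \<le> real N" for h
    proof -
      have "cmod (S h) \<le> real (card {max a (a-h)..<min b (b-h)})"
        unfolding S_def by (rule norm_sum_ep_le)
      also have "\<dots> \<le> real N" using ab by simp
      finally show ?thesis .
    qed
    have "(\<delta> * real N)\<^sup>2 \<le> (cmod (\<Sum>n\<in>{a..<b}. ep (p n)))\<^sup>2"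
      using big Suc.prems by (intro power_mono) auto
    also have "\<dots> \<le> (\<Sum>h\<in>HH. cmod (S h))"
      using weyl_differencing[OF ab, of p] by (simp add: S_def HH_def)
    also have "\<dots> \<le> (\<Sum>h\<in>HH. (if h \<in> H then real N else 0) + \<delta>\<^sup>2 / 4 * real N)"
      using SN Suc.prems by (intro sum_mono) (auto simp: H_def intro: add_increasing2)
    also have "\<dots> = real (card H) * real N + real (card HH) * (\<delta>\<^sup>2 / 4 * real N)"
    proof -
      have "(\<Sum>h\<in>HH. if h \<in> H then real N else 0) = (\<Sum>h\<in>HH \<inter> H. real N)"
        by (rule sum.inter_restrict[OF fin(1), symmetric])
      moreover have "HH \<inter> H = H" by (auto simp: H_def)
      ultimately show ?thesis by (simp add: sum.distrib)
    qed
    also have "\<dots> \<le> real (card H) * real N + (2 * real N) * (\<delta>\<^sup>2 / 4 * real N)"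
      using cardHH by (intro add_left_mono mult_right_mono) auto
    finally have "\<delta>\<^sup>2 / 2 * real N * real N \<le> real (card H) * real N"
      by (simp add: power2_eq_square algebra_simps)
    then have cardH: "\<delta>\<^sup>2 / 2 * real N \<le> real (card H)"
      using N by simp
    have "\<forall>h\<in>H. \<exists>q\<in>{1..K}. near_int (real K / real N ^ Suc d) (real q * (of_int h * \<alpha>))"
    proof
      fix h assume "h \<in> H"
      then have "\<delta>\<^sup>2 / 4 * real N \<le> cmod (S h)" by (simp add: H_def)
      moreover have "polyseq (Suc d) (of_int h * \<alpha>) (\<lambda>n. p (n + h) - p n)"
        using p by (subst (asm) polyseq.simps) blast
      ultimately show "\<exists>q\<in>{1..K}. near_int (real K / real N ^ Suc d) (real q * (of_int h * \<alpha>))"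
        unfolding S_def using ab by (intro K[OF N]) auto
    qed
    then obtain q where q: "\<And>h. h \<in> H \<Longrightarrow> q h \<in> {1..K}"
      "\<And>h. h \<in> H \<Longrightarrow> near_int (real K / real N ^ Suc d) (real (q h) * (of_int h * \<alpha>))"
      by metis
    have "0 < \<delta>\<^sup>2 / 2 * real N" using Suc.prems N by simp
    then have "H \<noteq> {}" using cardH by fastforce
    \<comment> \<open>The denominator still depends on \<open>h\<close>. Keeping only the most
      frequent one costs a factor \<open>K\<close> in density and lets
      \<open>near_int_of_many_multiples\<close> act on the single number
      \<open>k * \<alpha>\<close>.\<close>
    have "\<exists>k\<in>{1..K}. \<delta>\<^sup>2 / (2 * real K) * real N \<le> real (card {h\<in>H. q h = k})"
    proof (rule pigeonhole_fibre)
      show "\<delta>\<^sup>2 / (2 * real K) * real N * real K \<le> real (card H)" using cardH K1 by simp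
    qed (use q fin \<open>H \<noteq> {}\<close> in auto)
    then obtain k where k: "k \<in> {1..K}" "\<delta>\<^sup>2 / (2 * real K) * real N \<le> real (card {h\<in>H. q h = k})"
      by blast
    have "\<exists>q\<in>{1..K'}. near_int (real K' / real N ^ Suc (Suc d)) (real q * (real k * \<alpha>))"
    proof (rule K'[OF N _ k(2)])
      show "{h\<in>H. q h = k} \<subseteq> {-int N<..<int N}" by (auto simp: H_def HH_def)
      show "\<forall>h\<in>{h\<in>H. q h = k}. near_int (real K / real N ^ Suc d) (of_int h * (real k * \<alpha>))"
        using q(2) by (auto simp: mult_ac)
    qed
    then obtain k' where k': "k' \<in> {1..K'}" "near_int (real K' / real N ^ Suc (Suc d)) (real k' * (real k * \<alpha>))"
      by blast
    have "near_int (real (K' * K) / real N ^ Suc (Suc d)) (real (k' * k) * \<alpha>)"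
    proof (rule near_int_mono)
      show "near_int (real K' / real N ^ Suc (Suc d)) (real (k' * k) * \<alpha>)"
        using k'(2) by (simp add: mult_ac)
      show "real K' / real N ^ Suc (Suc d) \<le> real (K' * K) / real N ^ Suc (Suc d)"
        using K1 mult_left_mono[of 1 "real K" "real K'"] by (intro divide_right_mono) auto
    qed
    moreover have "k' * k \<in> {1..K' * K}" using k k' by (auto intro: mult_le_mono)
    ultimately show "\<exists>q\<in>{1..K' * K}. near_int (real (K' * K) / real N ^ Suc (Suc d)) (real q * \<alpha>)"
      by blast
  qed (use K1 K'1 in auto)
qed

lemma weyl_inverse:
  fixes f :: "int poly" and \<delta> :: real
  assumes "\<delta> > 0" "degree f \<ge> 1" "lead_coeff f \<ge> 1"
  shows "\<exists>K::nat. K \<ge> 1 \<and> (\<forall>(N::nat) \<theta>. N \<ge> 1 \<longrightarrow> 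
      \<delta> * real N \<le> cmod (\<Sum>n<N. ep (of_int (poly f (int n)) * \<theta>)) \<longrightarrow>
      (\<exists>q\<in>{1..K}. near_int (real K / real N ^ degree f) (real q * \<theta>)))"
proof -
  obtain d where d: "degree f = Suc d" using assms(2) by (cases "degree f") auto
  from weyl_inverse_polyseq[OF assms(1), of d] obtain K :: nat where K1: "K \<ge> 1" and
    K: "\<And>(N::nat) a b p \<alpha>. N \<ge> 1 \<Longrightarrow> b - a \<le> int N \<Longrightarrow> polyseq (Suc d) \<alpha> p \<Longrightarrow>
      \<delta> * real N \<le> cmod (\<Sum>n\<in>{a..<b}. ep (p n)) \<Longrightarrow>
      \<exists>q\<in>{1..K}. near_int (real K / real N ^ Suc d) (real q * \<alpha>)" by blast
  \<comment> \<open>The top difference of \<open>\<theta> * f n\<close> is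
    \<open>\<theta> * c\<close>; the integer \<open>c\<close> is moved into the denominator
    \<open>q\<close> at the cost of enlarging \<open>K\<close>.\<close>
  define c where "c = fact (Suc d) * nat (lead_coeff f)"
  have c1: "c \<ge> 1" using assms(3) fact_ge_1[of "Suc d", where 'a = nat] by (simp add: c_def Suc_le_eq del: fact_Suc)
  show ?thesis
  proof (intro exI[of _ "K * c"] conjI allI impI)
    fix N :: nat and \<theta>
    assume N: "N \<ge> 1" and big: "\<delta> * real N \<le> cmod (\<Sum>n<N. ep (of_int (poly f (int n)) * \<theta>))"
    have "polyseq (Suc d) (\<theta> * (fact (Suc d) * of_int (coeff f (Suc d)))) (\<lambda>n. \<theta> * of_int (poly f n))"
      by (intro polyseq_cmult polyseq_poly) (simp add: d)
    moreover have "fact (Suc d) * of_int (coeff f (Suc d)) = real c"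
      using assms(3) by (simp add: c_def d del: fact_Suc)
    ultimately have p: "polyseq (Suc d) (\<theta> * real c) (\<lambda>n. \<theta> * of_int (poly f n))" by simp
    have "(\<Sum>n<N. ep (of_int (poly f (int n)) * \<theta>)) = (\<Sum>n\<in>{0..<int N}. ep (\<theta> * of_int (poly f n)))"
      by (rule sum.reindex_bij_witness[of _ nat int]) (auto simp: mult.commute)
    with big have "\<delta> * real N \<le> cmod (\<Sum>n\<in>{0..<int N}. ep (\<theta> * of_int (poly f n)))" by simp
    from K[OF N _ p this] obtain q where q: "q \<in> {1..K}"
      "near_int (real K / real N ^ Suc d) (real q * (\<theta> * real c))" by auto
    have "near_int (real (K * c) / real N ^ degree f) (real (q * c) * \<theta>)"
    proof (rule near_int_mono)
      show "near_int (real K / real N ^ Suc d) (real (q * c) * \<theta>)"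
        using q(2) by (simp add: mult_ac)
      show "real K / real N ^ Suc d \<le> real (K * c) / real N ^ degree f"
        unfolding d using c1 K1 by (intro divide_right_mono) auto
    qed
    moreover have "q * c \<in> {1..K * c}" using q c1 by (auto intro: mult_le_mono)
    ultimately show "\<exists>q\<in>{1..K * c}. near_int (real (K * c) / real N ^ degree f) (real q * \<theta>)" by blast
  qed (use K1 c1 in auto)
qed

subsection \<open>The ratio bound on a cyclic group\<close>

lemma ep_eq_1_imp_int:
  assumes "ep x = 1"
  shows "\<exists>z::int. x = of_int z"
proof -
  have "ep (x - of_int (round x)) = 1" using assms by (simp add: ep_diff)
  moreover have "\<bar>x - of_int (round x)\<bar> \<le> 1/2"
    using of_int_round_abs_le[of x] by (simp add: abs_minus_commute)
  ultimately have "\<bar>x - of_int (round x)\<bar> \<le> 0"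
    using norm_ep_minus_1_ge by fastforce
  then show ?thesis by auto
qed

lemma sum_ep_orthogonal:
  assumes "P \<ge> 1"
  shows "(\<Sum>\<xi><P. ep (real \<xi> * (of_int z / real P))) = (if int P dvd z then of_nat P else 0)"
proof (cases "int P dvd z")
  case True
  then obtain k where "z = int P * k" by (auto elim: dvdE)
  then have "ep (of_int z / real P) = 1" using assms by simp
  then have "ep (real \<xi> * (of_int z / real P)) = 1" for \<xi> by (simp only: ep_mult_of_nat power_one)
  then show ?thesis using True by simp
next
  case False
  define r where "r = ep (of_int z / real P)"
  have "r \<noteq> 1"
  proof
    assume "r = 1"
    then obtain k :: int where "of_int z / real P = of_int k"
      using ep_eq_1_imp_int unfolding r_def by blast
    then have "real_of_int z = real_of_int (k * int P)" using assms by (simp add: field_simps)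
    then have "z = k * int P" by (simp only: of_int_eq_iff)
    with False show False by simp
  qed
  moreover have "r ^ P = 1"
  proof -
    have "r ^ P = ep (of_nat P * (of_int z / real P))" unfolding r_def by (rule ep_mult_of_nat[symmetric])
    then show ?thesis using assms by simp
  qed
  ultimately have "(\<Sum>\<xi><P. r ^ \<xi>) = 0" by (simp add: geometric_sum)
  then show ?thesis using False unfolding r_def by (simp only: ep_mult_of_nat if_False)
qed

text \<open>The squared norm is the Fourier transform of the autocorrelation of \<open>A\<close>, so
  orthogonality picks out the pairs at difference \<open>w\<close> modulo \<open>P\<close>. The case
  \<open>w = 0\<close> is Parseval's identity.\<close>

lemma sum_norm_fourier_shift:
  assumes P: "P \<ge> 1" and A: "A \<subseteq> {..<P}"
  shows "(\<Sum>\<xi><P. (cmod (\<Sum>x\<in>A. ep (real \<xi> * (real x / real P))))\<^sup>2 * cos (2 * pi * (real \<xi> * (of_int w / real P))))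
    = real P * real (card {x\<in>A. nat ((int x + w) mod int P) \<in> A})"
proof -
  define F where "F = (\<lambda>\<xi>. \<Sum>x\<in>A. ep (real \<xi> * (real x / real P)))"
  have finA: "finite A" using A finite_subset by blast
  have eq: "of_real ((cmod (F \<xi>))\<^sup>2) * ep (real \<xi> * (of_int w / real P)) =
      (\<Sum>x\<in>A. \<Sum>y\<in>A. ep (real \<xi> * (of_int (int x - int y + w) / real P)))" for \<xi>
  proof -
    have "of_real ((cmod (F \<xi>))\<^sup>2) = F \<xi> * cnj (F \<xi>)" by (simp only: complex_norm_square)
    also have "\<dots> = (\<Sum>x\<in>A. \<Sum>y\<in>A. ep (real \<xi> * (real x / real P) - real \<xi> * (real y / real P)))"
      by (simp add: F_def sum_product ep_diff)
    finally have "of_real ((cmod (F \<xi>))\<^sup>2) * ep (real \<xi> * (of_int w / real P)) =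
      (\<Sum>x\<in>A. \<Sum>y\<in>A. ep (real \<xi> * (real x / real P) - real \<xi> * (real y / real P)) * ep (real \<xi> * (of_int w / real P)))"
      by (simp add: sum_distrib_right)
    also have "\<dots> = (\<Sum>x\<in>A. \<Sum>y\<in>A. ep (real \<xi> * (of_int (int x - int y + w) / real P)))"
    proof (intro sum.cong refl)
      fix x y
      have "real \<xi> * (of_int (int x - int y + w) / real P) =
        real \<xi> * (real x / real P) - real \<xi> * (real y / real P) + real \<xi> * (of_int w / real P)"
        by (simp add: algebra_simps add_divide_distrib diff_divide_distrib)
      then show "ep (real \<xi> * (real x / real P) - real \<xi> * (real y / real P)) * ep (real \<xi> * (of_int w / real P))
        = ep (real \<xi> * (of_int (int x - int y + w) / real P))"
        by (simp only: ep_add)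
    qed
    finally show ?thesis .
  qed
  have "(\<Sum>\<xi><P. of_real ((cmod (F \<xi>))\<^sup>2) * ep (real \<xi> * (of_int w / real P))) =
      (\<Sum>x\<in>A. \<Sum>y\<in>A. \<Sum>\<xi><P. ep (real \<xi> * (of_int (int x - int y + w) / real P)))"
    unfolding eq by (subst sum.swap, rule sum.cong[OF refl], rule sum.swap)
  also have "\<dots> = (\<Sum>x\<in>A. \<Sum>y\<in>A. if int P dvd int x - int y + w then of_nat P else 0)"
    by (intro sum.cong refl sum_ep_orthogonal P)
  also have "\<dots> = (\<Sum>x\<in>A. if nat ((int x + w) mod int P) \<in> A then of_nat P else 0)"
  proof (rule sum.cong[OF refl])
    fix x assume x: "x \<in> A"
    have "(int P dvd int x - int y + w) = (nat ((int x + w) mod int P) = y)" if "y \<in> A" for y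
    proof -
      have "y < P" using that A by auto
      then have "int y = int y mod int P" by simp
      moreover have "(int P dvd int x - int y + w) = ((int x + w) mod int P = int y mod int P)"
        by (simp add: mod_eq_dvd_iff algebra_simps)
      ultimately show ?thesis using P by (simp add: nat_eq_iff) 
    qed
    then have "(\<Sum>y\<in>A. if int P dvd int x - int y + w then of_nat P else (0::complex)) =
      (\<Sum>y\<in>A. if nat ((int x + w) mod int P) = y then of_nat P else 0)"
      by (intro sum.cong refl) simp
    also have "\<dots> = (if nat ((int x + w) mod int P) \<in> A then of_nat P else 0)"
      using finA by (simp add: sum.delta')
    finally show "(\<Sum>y\<in>A. if int P dvd int x - int y + w then of_nat P else (0::complex)) =
      (if nat ((int x + w) mod int P) \<in> A then of_nat P else 0)" .
  qed
  also have "\<dots> = of_nat (card {x\<in>A. nat ((int x + w) mod int P) \<in> A}) * of_nat P"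
    using finA by (simp add: sum.If_cases Int_def)
  finally have "Re (\<Sum>\<xi><P. of_real ((cmod (F \<xi>))\<^sup>2) * ep (real \<xi> * (of_int w / real P))) =
    Re (of_nat (card {x\<in>A. nat ((int x + w) mod int P) \<in> A}) * of_nat P)" by simp
  then show ?thesis by (simp add: F_def Re_ep mult.commute)
qed

text \<open>Hoffman's argument in quantitative form. For each colour class, frequency 0 carries the
  square of the class size with multiplier 1, and no multiplier is below -\<epsilon>. Parseval
  controls the total spectral mass, and Cauchy-Schwarz bounds the sum of squared class sizes from
  below. Monochromatic pairs are counted rather than excluded, since carries in the cyclic model can
  create some.\<close>

lemma ratio_bound:
  fixes C :: "nat \<Rightarrow> 'c" and w :: "'s \<Rightarrow> int" and wt :: "'s \<Rightarrow> real"
  assumes P: "P \<ge> 1" and Col: "finite Col" "C ` {..<P} \<subseteq> Col"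
    and S: "finite S" "\<And>s. s \<in> S \<Longrightarrow> wt s \<ge> 0" "sum wt S = 1" and \<epsilon>: "\<epsilon> \<ge> 0"
    and h: "\<And>\<xi>. \<xi> < P \<Longrightarrow> - \<epsilon> \<le> (\<Sum>s\<in>S. wt s * cos (2 * pi * (real \<xi> * (of_int (w s) / real P))))"
  shows "(1 / real (card Col) - \<epsilon>) * real P \<le>
    (\<Sum>s\<in>S. wt s * real (card {x\<in>{..<P}. C (nat ((int x + w s) mod int P)) = C x}))"
proof -
  define A where "A = (\<lambda>a. {x\<in>{..<P}. C x = a})"
  define F where "F = (\<lambda>a \<xi>. (cmod (\<Sum>x\<in>A a. ep (real \<xi> * (real x / real P))))\<^sup>2)"
  define g where "g = (\<lambda>\<xi>. \<Sum>s\<in>S. wt s * cos (2 * pi * (real \<xi> * (of_int (w s) / real P))))"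
  define sh where "sh = (\<lambda>s x. nat ((int x + w s) mod int P))"
  have Asub: "A a \<subseteq> {..<P}" for a by (auto simp: A_def)
  have key: "(\<Sum>\<xi><P. F a \<xi> * cos (2 * pi * (real \<xi> * (of_int (w s) / real P)))) =
    real P * real (card {x\<in>A a. sh s x \<in> A a})" for a s
    unfolding F_def sh_def by (rule sum_norm_fourier_shift[OF P Asub])
  have parseval: "(\<Sum>\<xi><P. F a \<xi>) = real P * real (card (A a))" for a
  proof -
    have "{x\<in>A a. nat ((int x + 0) mod int P) \<in> A a} = A a" using Asub[of a] by auto
    then show ?thesis
      using sum_norm_fourier_shift[OF P Asub, of a 0] by (simp add: F_def)
  qed
  have F0: "F a 0 = (real (card (A a)))\<^sup>2" for a by (simp add: F_def)
  have split: "card {x\<in>{..<P}. Q x} = (\<Sum>a\<in>Col. card {x\<in>A a. Q x})" for Q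
  proof -
    have "{x\<in>{..<P}. Q x} = (\<Union>a\<in>Col. {x\<in>A a. Q x})" using Col by (auto simp: A_def)
    then have "card {x\<in>{..<P}. Q x} = card (\<Union>a\<in>Col. {x\<in>A a. Q x})" by simp
    also have "\<dots> = (\<Sum>a\<in>Col. card {x\<in>A a. Q x})"
      using Col by (intro card_UN_disjoint) (auto simp: A_def)
    finally show ?thesis .
  qed
  have total: "(\<Sum>a\<in>Col. card (A a)) = P" using split[of "\<lambda>_. True"] by simp
  have Colne: "card Col > 0" 
  proof -
    have "C 0 \<in> Col" using Col P by auto
    then show ?thesis using Col by (auto simp: card_gt_0_iff)
  qed
  have cs: "(real P)\<^sup>2 / real (card Col) \<le> (\<Sum>a\<in>Col. (real (card (A a)))\<^sup>2)"
  proof -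
    have "(\<Sum>a\<in>Col. real (card (A a)))\<^sup>2 \<le> (\<Sum>a\<in>Col. (real (card (A a)))\<^sup>2) * card Col"
      by (rule sum_squared_le_sum_of_squares)
    moreover have "(\<Sum>a\<in>Col. real (card (A a))) = real P" by (simp flip: total)
    ultimately show ?thesis using Colne by (simp add: field_simps)
  qed
  have count: "card {x\<in>{..<P}. C (sh s x) = C x} = (\<Sum>a\<in>Col. card {x\<in>A a. sh s x \<in> A a})" for s
    unfolding split using P by (intro sum.cong refl arg_cong[of _ _ card]) (auto simp: A_def sh_def nat_less_iff)
  have "real P * ((1 / real (card Col) - \<epsilon>) * real P) = (real P)\<^sup>2 / card Col - \<epsilon> * (real P * real P)"
    by (simp add: power2_eq_square field_simps)
  also have "\<dots> \<le> (\<Sum>a\<in>Col. F a 0) - \<epsilon> * (real P * real P)"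
    using cs by (simp add: F0)
  also have "real P * real P = (\<Sum>a\<in>Col. \<Sum>\<xi><P. F a \<xi>)"
    unfolding parseval sum_distrib_left[symmetric] by (simp flip: total)
  also have "(\<Sum>a\<in>Col. F a 0) - \<epsilon> * (\<Sum>a\<in>Col. \<Sum>\<xi><P. F a \<xi>) =
      (\<Sum>a\<in>Col. \<Sum>\<xi><P. F a \<xi> * ((if \<xi> = 0 then 1 else 0) - \<epsilon>))"
  proof -
    have "(\<Sum>\<xi><P. F a \<xi> * ((if \<xi> = 0 then 1 else 0) - \<epsilon>)) = F a 0 - \<epsilon> * (\<Sum>\<xi><P. F a \<xi>)" for a
    proof -
      have "(\<Sum>\<xi><P. F a \<xi> * ((if \<xi> = 0 then 1 else 0) - \<epsilon>)) =
        (\<Sum>\<xi><P. (if \<xi> = 0 then F a \<xi> else 0) - \<epsilon> * F a \<xi>)"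
        by (intro sum.cong) (auto simp: algebra_simps)
      also have "\<dots> = F a 0 - \<epsilon> * (\<Sum>\<xi><P. F a \<xi>)"
        using P by (simp add: sum_subtractf sum_distrib_left)
      finally show ?thesis .
    qed
    then show ?thesis by (simp add: sum_subtractf sum_distrib_left)
  qed
  \<comment> \<open>At frequency 0 the weights sum to 1 and \<epsilon> \<ge> 0; at the other
    frequencies this is the hypothesis \<open>h\<close>.\<close>
  also have "\<dots> \<le> (\<Sum>a\<in>Col. \<Sum>\<xi><P. F a \<xi> * g \<xi>)"
  proof (intro sum_mono mult_left_mono)
    fix \<xi> assume "\<xi> \<in> {..<P}"
    then show "(if \<xi> = 0 then 1 else 0) - \<epsilon> \<le> g \<xi>"
      using h[of \<xi>] S(3) \<epsilon> by (auto simp: g_def)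
  qed (simp add: F_def)
  also have "\<dots> = (\<Sum>a\<in>Col. \<Sum>s\<in>S. wt s * (real P * real (card {x\<in>A a. sh s x \<in> A a})))"
  proof (rule sum.cong[OF refl])
    fix a
    have "(\<Sum>\<xi><P. F a \<xi> * g \<xi>) = (\<Sum>\<xi><P. \<Sum>s\<in>S. wt s * (F a \<xi> * cos (2 * pi * (real \<xi> * (of_int (w s) / real P)))))"
      by (simp add: g_def sum_distrib_left mult_ac)
    also have "\<dots> = (\<Sum>s\<in>S. wt s * (real P * real (card {x\<in>A a. sh s x \<in> A a})))"
      by (subst sum.swap) (simp only: sum_distrib_left[symmetric] key)
    finally show "(\<Sum>\<xi><P. F a \<xi> * g \<xi>) = (\<Sum>s\<in>S. wt s * (real P * real (card {x\<in>A a. sh s x \<in> A a})))" .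
  qed
  also have "\<dots> = real P * (\<Sum>s\<in>S. wt s * real (card {x\<in>{..<P}. C (sh s x) = C x}))"
    unfolding sum_distrib_left count of_nat_sum by (subst sum.swap) (simp only: mult_ac)
  finally show ?thesis using P unfolding sh_def by simp
qed

subsection \<open>Phases of the powers of a unit vector\<close>

text \<open>
  If \<open>u + 1 / u = 1 / b\<close>, then \<open>(u ^ n - u powi (- n)) / (u - 1 / u) = lucas b n / b ^ (n - 1)\<close> for
  \<open>n \<ge> 1\<close>.
\<close>
fun lucas :: "int \<Rightarrow> nat \<Rightarrow> int" where
  "lucas b 0 = 0"
| "lucas b (Suc 0) = 1"
| "lucas b (Suc (Suc n)) = lucas b (Suc n) - b\<^sup>2 * lucas b n"

text \<open>Modulo \<open>b\<close> the recurrence merely copies the previous value, starting from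
  1.\<close>

lemma lucas_mod: "\<exists>k. lucas b (Suc n) = 1 + b * k"
proof (induction n rule: less_induct)
  case (less n)
  show ?case
  proof (cases n)
    case (Suc m)
    obtain k where "lucas b n = 1 + b * k" using less.IH[of m] Suc by auto
    then have "lucas b (Suc n) = 1 + b * (k - b * lucas b m)"
      using Suc by (simp add: algebra_simps power2_eq_square)
    then show ?thesis by blast
  qed simp
qed

text \<open>The rescaled sequence \<open>b ^ i * \<phi> i\<close> satisfies the recurrence of
  \<open>lucas\<close>, hence is a combination of its shifts. The recurrence is assumed only up to
  \<open>m\<close> so that the lemma also applies to a sequence read backwards from
  \<open>j\<close>.\<close>

lemma recurrence_power:
  fixes \<phi> :: "nat \<Rightarrow> real"
  assumes "\<And>i. i + 2 \<le> m \<Longrightarrow> of_int b * \<phi> (i + 2) + of_int b * \<phi> i = \<phi> (i + 1)"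
  shows "n + 1 \<le> m \<Longrightarrow> of_int b ^ (n + 1) * \<phi> (n + 1) =
    of_int (lucas b (n + 1)) * (of_int b * \<phi> 1) - (of_int b)\<^sup>2 * of_int (lucas b n) * \<phi> 0"
proof (induction n rule: less_induct)
  case (less n)
  consider "n = 0" | "n = 1" | k where "n = k + 2"
    by (metis One_nat_def Suc_1 add.commute add_2_eq_Suc not0_implies_Suc numeral_2_eq_2)
  then show ?case
  proof cases
    case 2
    have "of_int b * \<phi> 2 = \<phi> 1 - of_int b * \<phi> 0" using assms[of 0] less.prems 2 by (simp add: numeral_2_eq_2)
    then have "of_int b * (of_int b * \<phi> 2) = of_int b * (\<phi> 1 - of_int b * \<phi> 0)" by simp
    then show ?thesis using 2 by (simp add: numeral_2_eq_2 algebra_simps power2_eq_square)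
  next
    case (3 k)
    let ?b = "of_int b :: real"
    have 1: "?b ^ (k + 1) * \<phi> (k + 1) = of_int (lucas b (k + 1)) * (?b * \<phi> 1) - ?b\<^sup>2 * of_int (lucas b k) * \<phi> 0"
      using less.IH[of k] less.prems 3 by simp
    have 2: "?b ^ (k + 2) * \<phi> (k + 2) = of_int (lucas b (k + 2)) * (?b * \<phi> 1) - ?b\<^sup>2 * of_int (lucas b (k + 1)) * \<phi> 0"
      using less.IH[of "k + 1"] less.prems 3 by simp
    have "?b * \<phi> (k + 3) = \<phi> (k + 2) - ?b * \<phi> (k + 1)"
      using assms[of "k + 1"] less.prems 3 by (simp add: numeral_3_eq_3)
    then have "?b ^ (k + 2) * (?b * \<phi> (k + 3)) = ?b ^ (k + 2) * (\<phi> (k + 2) - ?b * \<phi> (k + 1))"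
      by simp
    also have "\<dots> = ?b ^ (k + 2) * \<phi> (k + 2) - ?b\<^sup>2 * (?b ^ (k + 1) * \<phi> (k + 1))"
      by (simp add: algebra_simps power2_eq_square)
    also have "\<dots> = of_int (lucas b (k + 2) - b\<^sup>2 * lucas b (k + 1)) * (?b * \<phi> 1)
        - ?b\<^sup>2 * of_int (lucas b (k + 1) - b\<^sup>2 * lucas b k) * \<phi> 0"
      unfolding 1 2 by (simp add: algebra_simps)
    also have "lucas b (k + 2) - b\<^sup>2 * lucas b (k + 1) = lucas b (n + 1)" using 3 by simp
    also have "lucas b (k + 1) - b\<^sup>2 * lucas b k = lucas b n" using 3 by simp
    also have "?b ^ (k + 2) * (?b * \<phi> (k + 3)) = ?b ^ (n + 1) * \<phi> (n + 1)"
      using 3 by (simp add: numeral_3_eq_3 mult_ac)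
    finally show ?thesis .
  qed simp
qed

text \<open>
  Eliminating the neighbours of \<open>j\<close> gives \<open>E * \<theta> j\<close> as an integer combination of \<open>b * \<theta> i\<close> and
  \<open>b * \<theta> k\<close>, where \<open>E\<close> is congruent to 1 modulo \<open>b\<close>; the third summand accounts for \<open>E - 1\<close>.
\<close>
lemma middle_phase_combination:
  fixes b :: int and i j k :: nat
  assumes "i < j" "j < k"
  shows "\<exists>c1 c2 c3 :: int. \<forall>\<theta> :: nat \<Rightarrow> real. (\<forall>i. of_int b * \<theta> (i + 2) + of_int b * \<theta> i = \<theta> (i + 1)) \<longrightarrow>
    \<theta> j = of_int c1 * (of_int b * \<theta> i) + of_int c2 * (of_int b * \<theta> k) + of_int c3 * (of_int b * (\<theta> j :: real))"
proof -
  define l where "l = j - i - 1"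
  define n where "n = k - j - 1"
  have ln: "j = i + l + 1" "k = j + n + 1" using assms by (auto simp: l_def n_def)
  obtain x where x: "lucas b (l + 1) = 1 + b * x" using lucas_mod[of b l] by auto
  obtain y where y: "lucas b (n + 1) = 1 + b * y" using lucas_mod[of b n] by auto
  \<comment> \<open>Chosen so that \<open>1 + b * z\<close> is the coefficient \<open>E\<close>
    after expanding \<open>(1 + b * x) * (1 + b * y)\<close>.\<close>
  define z where "z = x + y + b * x * y - b * (lucas b (l + 1) * lucas b n + lucas b (n + 1) * lucas b l)"
  have "\<theta> j = of_int (lucas b (n + 1) * b ^ l) * (of_int b * \<theta> i) + of_int (lucas b (l + 1) * b ^ n) * (of_int b * \<theta> k)
      + of_int (- z) * (of_int b * \<theta> j)"
    if rec: "\<forall>i. of_int b * \<theta> (i + 2) + of_int b * \<theta> i = \<theta> (i + 1)" for \<theta> :: "nat \<Rightarrow> real"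
  proof -
    let ?b = "of_int b :: real"
    have fwd: "?b ^ (n + 1) * \<theta> k = of_int (lucas b (n + 1)) * (?b * \<theta> (j + 1)) - ?b\<^sup>2 * of_int (lucas b n) * \<theta> j"
      using recurrence_power[of "n + 1" b "\<lambda>i. \<theta> (j + i)" n] rec[rule_format, of "j + _"] ln
      by (simp add: add_ac)
    \<comment> \<open>The recurrence is symmetric under reversal; the bound
      \<open>m + 2 \<le> l + 1\<close> keeps the natural subtraction \<open>j - (m + 2)\<close>
      exact.\<close>
    have bwd: "?b ^ (l + 1) * \<theta> i = of_int (lucas b (l + 1)) * (?b * \<theta> (j - 1)) - ?b\<^sup>2 * of_int (lucas b l) * \<theta> j"
    proof -
      have "?b * \<theta> (j - (m + 2)) + ?b * \<theta> (j - m) = \<theta> (j - (m + 1))" if "m + 2 \<le> l + 1" for m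
      proof -
        have "j - (m + 2) + 2 = j - m" "j - (m + 2) + 1 = j - (m + 1)" using that ln by auto
        with rec[rule_format, of "j - (m + 2)"] show ?thesis by (simp add: add.commute)
      qed
      from recurrence_power[of "l + 1" b "\<lambda>m. \<theta> (j - m)" l, OF this] show ?thesis using ln by simp
    qed
    have mid: "?b * \<theta> (j + 1) + ?b * \<theta> (j - 1) = \<theta> j"
    proof -
      have "j - 1 + 2 = j + 1" "j - 1 + 1 = j" using ln by auto
      with rec[rule_format, of "j - 1"] show ?thesis by simp
    qed
    \<comment> \<open>Cross-weighting by the two Lucas numbers gives both neighbours of
      \<open>j\<close> the same coefficient, so they enter only through the sum that
      \<open>mid\<close> evaluates.\<close>
    have "of_int (lucas b (n + 1)) * (?b ^ (l + 1) * \<theta> i) + of_int (lucas b (l + 1)) * (?b ^ (n + 1) * \<theta> k)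
      = of_int (lucas b (n + 1) * lucas b (l + 1)) * (?b * \<theta> (j + 1) + ?b * \<theta> (j - 1))
        - ?b\<^sup>2 * of_int (lucas b (l + 1) * lucas b n + lucas b (n + 1) * lucas b l) * \<theta> j"
      unfolding fwd bwd by (simp add: algebra_simps)
    also have "\<dots> = of_int (lucas b (n + 1) * lucas b (l + 1)
        - b\<^sup>2 * (lucas b (l + 1) * lucas b n + lucas b (n + 1) * lucas b l)) * \<theta> j"
      unfolding mid by (simp add: algebra_simps)
    also have "lucas b (n + 1) * lucas b (l + 1)
        - b\<^sup>2 * (lucas b (l + 1) * lucas b n + lucas b (n + 1) * lucas b l) = 1 + b * z"
      unfolding z_def x y by (simp add: algebra_simps power2_eq_square)
    finally show ?thesis by (simp add: algebra_simps)
  qed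
  then show ?thesis by blast
qed

text \<open>Only finitely many triples lie below \<open>J\<close>, so one \<open>B0\<close> bounds
  all coefficients of \<open>middle_phase_combination\<close>; its three summands give
  \<open>3 * B0\<close>. The constant is uniform in \<theta> and \<eta>, so it can be fixed before
  the scales are chosen.\<close>

lemma middle_phase_near_int:
  fixes b :: nat
  shows "\<exists>B::real. B > 0 \<and> (\<forall>(\<theta> :: nat \<Rightarrow> real) \<eta> i j k. (\<forall>i. real b * \<theta> (i + 2) + real b * \<theta> i = \<theta> (i + 1)) \<longrightarrow>
    i < j \<longrightarrow> j < k \<longrightarrow> k < J \<longrightarrow> 
    near_int \<eta> (real b * \<theta> i) \<longrightarrow> near_int \<eta> (real b * \<theta> j) \<longrightarrow> near_int \<eta> (real b * \<theta> k) \<longrightarrow>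
    near_int (B * \<eta>) (\<theta> j))"
proof -
  have "\<forall>i j k. \<exists>c1 c2 c3 :: int. i < j \<and> j < k \<longrightarrow> (\<forall>\<theta> :: nat \<Rightarrow> real. (\<forall>i. real b * \<theta> (i + 2) + real b * \<theta> i = \<theta> (i + 1)) \<longrightarrow>
    \<theta> j = of_int c1 * (real b * \<theta> i) + of_int c2 * (real b * \<theta> k) + of_int c3 * (real b * (\<theta> j :: real)))"
    using middle_phase_combination[of _ _ _ "int b"] by auto
  then obtain c1 c2 c3 :: "nat \<Rightarrow> nat \<Rightarrow> nat \<Rightarrow> int" where
    c: "\<And>i j k \<theta>. i < j \<Longrightarrow> j < k \<Longrightarrow> \<forall>i. real b * \<theta> (i + 2) + real b * \<theta> i = \<theta> (i + 1) \<Longrightarrow>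
    \<theta> j = of_int (c1 i j k) * (real b * \<theta> i) + of_int (c2 i j k) * (real b * \<theta> k) + of_int (c3 i j k) * (real b * (\<theta> j :: real))"
    by metis
  define X where "X = (\<lambda>(i,j,k). \<bar>of_int (c1 i j k)\<bar> + \<bar>of_int (c2 i j k)\<bar> + \<bar>of_int (c3 i j k) :: real\<bar>) ` ({..<J} \<times> {..<J} \<times> {..<J})"
  define B0 where "B0 = Max (insert 1 X)"
  have finX: "finite X" by (simp add: X_def)
  have B0: "B0 \<ge> 1" using finX by (simp add: B0_def)
  have B0X: "x \<le> B0" if "x \<in> X" for x using finX that by (simp add: B0_def)
  show ?thesis
  proof (intro exI[of _ "3 * B0"] conjI allI impI)
    fix \<theta> \<eta> i j k
    assume rec: "\<forall>i. real b * \<theta> (i + 2) + real b * \<theta> i = \<theta> (i + 1)" and ijk: "i < j" "j < k" "k < J"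
      and near: "near_int \<eta> (real b * \<theta> i)" "near_int \<eta> (real b * \<theta> j)" "near_int \<eta> (real b * \<theta> k)"
    have "\<bar>of_int (c1 i j k)\<bar> + \<bar>of_int (c2 i j k)\<bar> + \<bar>of_int (c3 i j k) :: real\<bar> \<in> X"
      unfolding X_def using ijk by (intro image_eqI[of _ _ "(i, j, k)"]) auto
    from B0X[OF this] have "\<bar>of_int (c1 i j k)\<bar> \<le> B0" "\<bar>of_int (c2 i j k)\<bar> \<le> B0" "\<bar>of_int (c3 i j k)\<bar> \<le> B0"
      by linarith+
    then have "near_int (B0 * \<eta> + B0 * \<eta> + B0 * \<eta>) (\<theta> j)"
      by (subst c[OF ijk(1,2) rec]) (intro near_int_add near_int_mult near)
    then show "near_int (3 * B0 * \<eta>) (\<theta> j)" by (simp add: mult.assoc)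
  qed (use B0 in auto)
qed

section \<open>A lower bound for the Fourier transform, averaged over scales and powers\<close>

lemma abs_poly_le:
  fixes f :: "int poly"
  assumes "n < N"
  shows "\<bar>of_int (poly f (int n))\<bar> \<le> (\<Sum>i\<le>degree f. \<bar>of_int (coeff f i) :: real\<bar>) * real N ^ degree f"
proof -
  have "\<bar>of_int (poly f (int n)) :: real\<bar> = \<bar>\<Sum>i\<le>degree f. of_int (coeff f i) * real n ^ i\<bar>"
    by (simp add: poly_altdef)
  also have "\<dots> \<le> (\<Sum>i\<le>degree f. \<bar>of_int (coeff f i)\<bar> * real N ^ degree f)"
  proof (rule order_trans[OF sum_abs], rule sum_mono)
    fix i assume "i \<in> {..degree f}"
    then have "real n ^ i \<le> real N ^ degree f"
      using assms by (intro order_trans[OF power_mono[of "real n" "real N"] power_increasing]) auto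
    then show "\<bar>of_int (coeff f i) * real n ^ i\<bar> \<le> \<bar>of_int (coeff f i)\<bar> * real N ^ degree f"
      by (simp add: abs_mult mult_left_mono)
  qed
  finally show ?thesis by (simp add: sum_distrib_right)
qed

lemma cos_near_int_nonneg:
  assumes "near_int \<eta> x" "\<bar>of_int m\<bar> * \<eta> \<le> 1/4"
  shows "cos (2 * pi * (of_int m * x)) \<ge> 0"
proof -
  obtain z :: int where z: "\<bar>x - of_int z\<bar> \<le> \<eta>" using assms unfolding near_int_def by blast
  define y where "y = of_int m * (x - of_int z)"
  have "\<bar>y\<bar> \<le> \<bar>of_int m\<bar> * \<eta>" unfolding y_def abs_mult using z by (intro mult_left_mono) auto
  then have y: "\<bar>y\<bar> \<le> 1/4" using assms(2) by linarith
  have "\<bar>2 * pi * y\<bar> = 2 * pi * \<bar>y\<bar>" by (simp add: abs_mult)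
  also have "\<dots> \<le> 2 * pi * (1/4)" using y by (intro mult_left_mono) auto
  finally have "\<bar>2 * pi * y\<bar> \<le> pi / 2" by simp
  then have "cos (2 * pi * y) \<ge> 0" by (intro cos_ge_zero) linarith+
  moreover have "ep (of_int m * x) = ep (y + of_int (m * z))" by (simp add: y_def algebra_simps)
  then have "ep (of_int m * x) = ep y" by (simp add: ep_add del: of_int_mult)
  ultimately show ?thesis by (metis Re_ep)
qed

text \<open>Every pair of a scale and an index costs \<delta>. Beyond that, each scale loses at most
  2, for its first and last major index, and each index at most 1, for its single bad scale. Choices
  are made in the order \<open>K\<close>, \<open>b\<close>, \<open>B\<close>, \<open>R\<close>, all
  before \<theta> is given.\<close>

lemma spectral_lower_bound:
  fixes f :: "int poly" and \<delta> :: real and T J :: nat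
  assumes \<delta>: "\<delta> > 0" and f: "degree f \<ge> 1" "lead_coeff f \<ge> 1"
  shows "\<exists>(b::nat) N::nat \<Rightarrow> nat. b \<ge> 2 \<and> (\<forall>t. N t \<ge> 1) \<and>
    (\<forall>\<theta> :: nat \<Rightarrow> real. (\<forall>i. real b * \<theta> (i + 2) + real b * \<theta> i = \<theta> (i + 1)) \<longrightarrow>
      - (\<delta> * T * J + 2 * T + J) \<le>
      (\<Sum>t<T. \<Sum>j<J. (\<Sum>n<N t. cos (2 * pi * (of_int (poly f (int n)) * \<theta> j))) / real (N t)))"
proof -
  define r where "r = degree f"
  from weyl_inverse[OF \<delta> f] obtain K :: nat where K1: "K \<ge> 1" and
    K: "\<And>N \<theta>. N \<ge> 1 \<Longrightarrow> \<delta> * real N \<le> cmod (\<Sum>n<N. ep (of_int (poly f (int n)) * \<theta>)) \<Longrightarrow>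
      \<exists>q\<in>{1..K}. near_int (real K / real N ^ r) (real q * \<theta>)" unfolding r_def by blast
  \<comment> \<open>Every denominator \<open>q \<le> K\<close> divides \<open>fact K\<close>; the
    factor 2 ensures \<open>b \<ge> 2\<close> even when \<open>K = 1\<close>.\<close>
  define b :: nat where "b = 2 * fact K"
  have b2: "b \<ge> 2" unfolding b_def using fact_ge_1[of K, where 'a = nat] by simp
  from middle_phase_near_int[of b J] obtain B where B: "B > 0" and
    mid: "\<And>\<theta> \<eta> i j k. \<forall>i. real b * \<theta> (i + 2) + real b * \<theta> i = \<theta> (i + 1) \<Longrightarrow>
      i < j \<Longrightarrow> j < k \<Longrightarrow> k < J \<Longrightarrow> 
      near_int \<eta> (real b * \<theta> i) \<Longrightarrow> near_int \<eta> (real b * \<theta> j) \<Longrightarrow> near_int \<eta> (real b * \<theta> k) \<Longrightarrow>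
      near_int (B * \<eta>) (\<theta> j)" by blast
  define B' where "B' = B * (real b * real K)"
  define A where "A = (\<Sum>i\<le>degree f. \<bar>of_int (coeff f i) :: real\<bar>)"
  have "\<bar>of_int (lead_coeff f)\<bar> \<le> A" unfolding A_def by (intro member_le_sum) auto
  moreover have "1 \<le> \<bar>of_int (lead_coeff f) :: real\<bar>" using f(2) by linarith
  ultimately have A1: "A \<ge> 1" by linarith
  \<comment> \<open>For \<open>n < N\<close> the value |f n| is at most \<open>A * N ^ r\<close>, so
    a phase within \<open>\<kappa> / N ^ r\<close> of an integer moves by at most 1/4 from the
    integers when multiplied by \<open>f n\<close>, and the cosine stays nonnegative.\<close>
  define \<kappa> where "\<kappa> = 1 / (4 * A)"
  have \<kappa>: "\<kappa> > 0" using A1 by (simp add: \<kappa>_def)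
  \<comment> \<open>The ratio of consecutive scales: large enough that the tolerance
    \<open>B' / N ^ r\<close> at a later scale is already within the harmless \<kappa> tolerance of
    every earlier one.\<close>
  obtain R :: nat where R: "max 1 (B' / \<kappa>) \<le> real R" using real_arch_simple by blast
  then have R1: "R \<ge> 1" by simp
  define N where "N = (\<lambda>t. R ^ t)"
  have N1: "N t \<ge> 1" for t using R1 by (simp add: N_def)
  have scale: "B' / real (N t') ^ r \<le> \<kappa> / real (N t) ^ r" if "t < t'" for t t'
  proof -
    have "B' \<le> \<kappa> * real R" using R \<kappa> by (simp add: field_simps)
    also have "real R \<le> real R ^ r" using R1 f(1) power_increasing[of 1 r "real R"] by (simp add: r_def)
    finally have 1: "B' \<le> \<kappa> * real R ^ r" using \<kappa> by simp
    have "real R * real (N t) \<le> real (N t')"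
      using R1 that power_increasing[of "Suc t" t' "real R"] by (simp add: N_def)
    then have "(real R * real (N t)) ^ r \<le> real (N t') ^ r" by (intro power_mono) auto
    then have 2: "real R ^ r * real (N t) ^ r \<le> real (N t') ^ r" by (simp add: power_mult_distrib)
    have "B' * real (N t) ^ r \<le> \<kappa> * real R ^ r * real (N t) ^ r" using 1 by (intro mult_right_mono) auto
    also have "\<dots> \<le> \<kappa> * real (N t') ^ r" using 2 \<kappa> by (simp add: mult.assoc)
    finally have "B' * real (N t) ^ r \<le> \<kappa> * real (N t') ^ r" .
    moreover have "real (N t) ^ r > 0" "real (N t') ^ r > 0"
      using N1 by (auto intro!: zero_less_power simp: Suc_le_eq)
    ultimately show ?thesis by (simp add: field_simps)
  qed
  have "- (\<delta> * T * J + 2 * T + J) \<le>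
      (\<Sum>t<T. \<Sum>j<J. (\<Sum>n<N t. cos (2 * pi * (of_int (poly f (int n)) * \<theta> j))) / real (N t))"
    if rec: "\<forall>i. real b * \<theta> (i + 2) + real b * \<theta> i = \<theta> (i + 1)" for \<theta> :: "nat \<Rightarrow> real"
  proof -
    define val where "val = (\<lambda>t j. (\<Sum>n<N t. cos (2 * pi * (of_int (poly f (int n)) * \<theta> j))) / real (N t))"
    \<comment> \<open>Indices with a large Weyl sum; all of them but the first and the last have a phase near an
      integer, and this phase is harmful at no more than one scale.\<close>
    define Maj where "Maj = (\<lambda>t. {j\<in>{..<J}. \<delta> * real (N t) \<le> cmod (\<Sum>n<N t. ep (of_int (poly f (int n)) * \<theta> j))})"
    define Exc where "Exc = (\<lambda>t. {j\<in>Maj t. j = Min (Maj t) \<or> j = Max (Maj t)})"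
    define Bad where "Bad = (\<lambda>j. {t\<in>{..<T}. near_int (B' / real (N t) ^ r) (\<theta> j) \<and> \<not> near_int (\<kappa> / real (N t) ^ r) (\<theta> j)})"
    have finMaj: "finite (Maj t)" for t by (auto simp: Maj_def)
    have near_b: "near_int (real b * real K / real (N t) ^ r) (real b * \<theta> j)" if "j \<in> Maj t" for t j
    proof -
      have "\<exists>q\<in>{1..K}. near_int (real K / real (N t) ^ r) (real q * \<theta> j)"
        using that N1 by (intro K) (auto simp: Maj_def)
      then obtain q where q: "q \<in> {1..K}" "near_int (real K / real (N t) ^ r) (real q * \<theta> j)" by blast
      have "q dvd fact K" using q(1) by (intro dvd_fact) auto
      then have "q dvd b" by (simp add: b_def)
      then obtain m where m: "b = q * m" by (auto elim: dvdE)
      have "m \<le> b" using q(1) m by auto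
      then have "near_int (real b * (real K / real (N t) ^ r)) (of_int (int m) * (real q * \<theta> j))"
        by (intro near_int_mult q(2)) auto
      then show ?thesis by (simp add: m mult_ac)
    qed
    have near_mid: "near_int (B' / real (N t) ^ r) (\<theta> j)" if "j \<in> Maj t" "j \<notin> Exc t" for t j
    proof -
      define i where "i = Min (Maj t)"
      define k where "k = Max (Maj t)"
      have "Maj t \<noteq> {}" using that by auto
      then have ik: "i \<in> Maj t" "k \<in> Maj t" using finMaj[of t] by (auto simp: i_def k_def)
      have "i \<le> j" "j \<le> k" using finMaj[of t] that by (auto simp: i_def k_def)
      moreover have "i \<noteq> j" "j \<noteq> k" using that by (auto simp: Exc_def i_def k_def)
      moreover have "k < J" using ik by (auto simp: Maj_def)
      ultimately have "near_int (B * (real b * real K / real (N t) ^ r)) (\<theta> j)"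
        using near_b ik that by (intro mid[OF rec, of i j k]) auto
      then show ?thesis by (simp add: B'_def)
    qed
    have val_ge_m1: "val t j \<ge> - 1" for t j
    proof -
      have "(\<Sum>n<N t. (-1::real)) \<le> (\<Sum>n<N t. cos (2 * pi * (of_int (poly f (int n)) * \<theta> j)))"
        by (intro sum_mono) simp
      then show ?thesis using N1[of t] by (simp add: val_def field_simps)
    qed
    have val_minor: "val t j \<ge> - \<delta>" if "j \<in> {..<J}" "j \<notin> Maj t" for t j
    proof -
      have "- (\<delta> * real (N t)) \<le> - cmod (\<Sum>n<N t. ep (of_int (poly f (int n)) * \<theta> j))"
        using that by (simp add: Maj_def)
      also have "\<dots> \<le> Re (\<Sum>n<N t. ep (of_int (poly f (int n)) * \<theta> j))"
        using abs_Re_le_cmod[of "\<Sum>n<N t. ep (of_int (poly f (int n)) * \<theta> j)"] by linarith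
      also have "\<dots> = (\<Sum>n<N t. cos (2 * pi * (of_int (poly f (int n)) * \<theta> j)))"
        by (simp add: Re_ep)
      finally show ?thesis using N1[of t] by (simp add: val_def field_simps)
    qed
    have val_good: "val t j \<ge> 0" if "near_int (\<kappa> / real (N t) ^ r) (\<theta> j)" for t j
    proof -
      have "cos (2 * pi * (of_int (poly f (int n)) * \<theta> j)) \<ge> 0" if "n < N t" for n
      proof (rule cos_near_int_nonneg)
        have pos: "real (N t) ^ r > 0" using N1[of t] by simp
        have "\<bar>of_int (poly f (int n))\<bar> * (\<kappa> / real (N t) ^ r) \<le> (A * real (N t) ^ r) * (\<kappa> / real (N t) ^ r)"
          using abs_poly_le[OF that, of f] \<kappa> pos by (intro mult_right_mono) (auto simp: A_def r_def)
        also have "\<dots> = 1/4" using pos A1 by (simp add: \<kappa>_def)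
        finally show "\<bar>of_int (poly f (int n))\<bar> * (\<kappa> / real (N t) ^ r) \<le> 1/4" .
      qed fact
      then show ?thesis by (auto simp: val_def intro!: divide_nonneg_nonneg sum_nonneg)
    qed
    have pointwise: "- \<delta> - of_bool (j \<in> Exc t) - of_bool (t \<in> Bad j) \<le> val t j" if "t < T" "j < J" for t j
    proof (cases "j \<in> Maj t")
      case False
      then show ?thesis using val_minor[of j t] that by (auto simp: of_bool_def)
    next
      case True
      show ?thesis
      proof (cases "j \<in> Exc t \<or> t \<in> Bad j")
        case True
        then show ?thesis using val_ge_m1[of t j] \<delta> by (auto simp: of_bool_def)
      next
        case False
        then have "near_int (\<kappa> / real (N t) ^ r) (\<theta> j)"
          using near_mid[OF True] that by (auto simp: Bad_def)
        from val_good[OF this] show ?thesis using \<delta> False by simp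
      qed
    qed
    have Exc2: "(\<Sum>j<J. of_bool (j \<in> Exc t)) \<le> (2::real)" for t
    proof -
      have "{..<J} \<inter> Exc t \<subseteq> {Min (Maj t), Max (Maj t)}" by (auto simp: Exc_def)
      then have "card ({..<J} \<inter> Exc t) \<le> card {Min (Maj t), Max (Maj t)}" by (intro card_mono) auto
      also have "\<dots> \<le> 2" by (simp add: card_insert_if)
      finally show ?thesis by (simp add: of_bool_def sum.If_cases)
    qed
    have Bad1: "(\<Sum>t<T. of_bool (t \<in> Bad j)) \<le> (1::real)" for j
    proof -
      \<comment> \<open>If both scales were bad, the proximity to an integer known at the later
        \<open>t'\<close> would, by \<open>scale\<close>, make the phase harmless at
        \<open>t\<close>.\<close>
      have "\<not> t < t'" if "t \<in> Bad j" "t' \<in> Bad j" for t t'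
        using that scale[of t t'] near_int_mono[of "B' / real (N t') ^ r" "\<theta> j" "\<kappa> / real (N t) ^ r"]
        by (auto simp: Bad_def)
      then have "t = t'" if "t \<in> Bad j" "t' \<in> Bad j" for t t'
        using that by (meson linorder_neqE_nat)
      moreover have "finite (Bad j)" by (auto simp: Bad_def)
      ultimately have "card (Bad j) \<le> Suc 0" by (auto simp: card_le_Suc0_iff_eq)
      moreover have "{..<T} \<inter> Bad j = Bad j" by (auto simp: Bad_def)
      ultimately show ?thesis by (simp add: of_bool_def sum.If_cases)
    qed
    have "(\<Sum>t<T. \<Sum>j<J. - \<delta> - of_bool (j \<in> Exc t) - of_bool (t \<in> Bad j)) \<le> (\<Sum>t<T. \<Sum>j<J. val t j)"
      using pointwise by (intro sum_mono) auto
    moreover have "(\<Sum>t<T. \<Sum>j<J. - \<delta> - of_bool (j \<in> Exc t) - of_bool (t \<in> Bad j)) =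
        - (\<delta> * T * J) - (\<Sum>t<T. \<Sum>j<J. of_bool (j \<in> Exc t)) - (\<Sum>j<J. \<Sum>t<T. of_bool (t \<in> Bad j))"
      by (subst sum.swap[of "\<lambda>j t. of_bool (t \<in> Bad j)" "{..<T}" "{..<J}"]) (simp add: sum_subtractf)
    moreover have "(\<Sum>t<T. \<Sum>j<J. of_bool (j \<in> Exc t)) \<le> (\<Sum>t<T. (2::real))"
      by (intro sum_mono Exc2)
    moreover have "(\<Sum>j<J. \<Sum>t<T. of_bool (t \<in> Bad j)) \<le> (\<Sum>j<J. (1::real))"
      by (intro sum_mono Bad1)
    ultimately show ?thesis unfolding val_def by simp
  qed
  then show ?thesis using b2 N1 by blast
qed

subsection \<open>Colourings of the plane\<close>

text \<open>Coordinates of \<open>v ^ j\<close> in the basis \<open>1, v\<close>, where \<open>v = b * u\<close> is a root of \<open>v\<^sup>2 = v - b\<^sup>2\<close>.\<close>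
fun qpow :: "int \<Rightarrow> nat \<Rightarrow> int \<times> int" where
  "qpow b 0 = (1, 0)"
| "qpow b (Suc j) = (- b\<^sup>2 * snd (qpow b j), fst (qpow b j) + snd (qpow b j))"

lemma qpow_power:
  fixes v :: complex
  assumes "v\<^sup>2 = v - of_int (b\<^sup>2)"
  shows "v ^ j = of_int (fst (qpow b j)) + of_int (snd (qpow b j)) * v"
proof (induction j)
  case (Suc j)
  have "v ^ Suc j = of_int (fst (qpow b j)) * v + of_int (snd (qpow b j)) * v\<^sup>2"
    by (simp add: Suc power2_eq_square algebra_simps)
  also have "\<dots> = of_int (fst (qpow b (Suc j))) + of_int (snd (qpow b (Suc j))) * v"
    unfolding assms by (simp add: algebra_simps)
  finally show ?case .
qed simp

text \<open>Sampling \<open>f\<close> only from such an \<open>m\<close> on makes every sampled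
  value a genuine positive distance.\<close>

lemma exists_positive_shift:
  fixes f :: "int poly"
  assumes "lead_coeff f \<ge> 1"
  shows "\<exists>m::int. \<forall>n\<ge>m. poly f n \<ge> 1"
proof -
  let ?g = "map_poly real_of_int f"
  have "lead_coeff ?g = real_of_int (lead_coeff f)"
    by (simp add: coeff_map_poly degree_map_poly)
  then have "lead_coeff ?g > 0" using assms by simp
  from poly_pinfty_gt_lc[OF this] obtain x where x: "\<forall>y\<ge>x. lead_coeff ?g \<le> poly ?g y" by blast
  have "poly f n \<ge> 1" if "n \<ge> \<lceil>x\<rceil>" for n
  proof -
    have "real_of_int n \<ge> x" using that by linarith
    then have "poly ?g (real_of_int n) > 0" using x \<open>lead_coeff ?g > 0\<close> by force
    moreover have "poly ?g (real_of_int n) = real_of_int (poly f n)"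
      by (induction f) (simp_all add: map_poly_pCons)
    ultimately show ?thesis by linarith
  qed
  then show ?thesis by blast
qed

section \<open>Boxes of lattice points as residues modulo \<open>M^2\<close>\<close>

text \<open>Read \<open>x\<close> as two digits in base \<open>M\<close>. A shift by at most
  \<open>D\<close> pushes at most \<open>D\<close> values of one digit out of range, and the other
  digit has \<open>M\<close> values.\<close>

lemma card_carry_le:
  fixes a c :: int and D M :: nat
  assumes "\<bar>a\<bar> \<le> int D" "\<bar>c\<bar> \<le> int D"
  shows "card {x\<in>{..<M\<^sup>2}. \<not> (int (x mod M) + a \<in> {0..<int M} \<and> int (x div M) + c \<in> {0..<int M})} \<le> 2 * D * M"
proof -
  define out where "out = (\<lambda>a. {x\<in>{..<M}. int x + a \<notin> {0..<int M}})"
  have out: "card (out a) \<le> D" if "\<bar>a\<bar> \<le> int D" for a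
  proof (cases "a \<ge> 0")
    case True
    then have "out a \<subseteq> {M - nat a..<M}" by (auto simp: out_def)
    then have "card (out a) \<le> card {M - nat a..<M}" by (intro card_mono) auto
    also have "\<dots> \<le> D" using that True by auto
    finally show ?thesis .
  next
    case False
    then have "out a \<subseteq> {..<nat (- a)}" by (auto simp: out_def)
    then have "card (out a) \<le> card {..<nat (- a)}" by (intro card_mono) auto
    also have "\<dots> \<le> D" using that False by auto
    finally show ?thesis .
  qed
  let ?B = "{x\<in>{..<M\<^sup>2}. \<not> (int (x mod M) + a \<in> {0..<int M} \<and> int (x div M) + c \<in> {0..<int M})}"
  let ?U = "out a \<times> {..<M} \<union> {..<M} \<times> out c"
  have fin: "finite (out a)" for a by (simp add: out_def)
  have "?B \<subseteq> (\<lambda>(y, z). y + M * z) ` ?U"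
  proof
    fix x assume x: "x \<in> ?B"
    then have "x < M * M" by (simp add: power2_eq_square)
    then have "M > 0" by (cases M) auto
    then have "x mod M < M" "x div M < M" using \<open>x < M * M\<close> by (auto simp: less_mult_imp_div_less)
    then have "(x mod M, x div M) \<in> ?U" using x by (auto simp: out_def)
    then show "x \<in> (\<lambda>(y, z). y + M * z) ` ?U" by (intro image_eqI[of _ _ "(x mod M, x div M)"]) auto
  qed
  then have "card ?B \<le> card ((\<lambda>(y, z). y + M * z) ` ?U)" using fin by (intro card_mono) auto
  also have "\<dots> \<le> card ?U" using fin by (intro card_image_le) auto
  also have "\<dots> \<le> card (out a \<times> {..<M}) + card ({..<M} \<times> out c)" by (rule card_Un_le)
  also have "\<dots> = card (out a) * M + M * card (out c)" by (simp add: card_cartesian_product)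
  also have "\<dots> \<le> D * M + M * D" using out assms by (intro add_mono mult_mono) auto
  finally show ?thesis by (simp add: algebra_simps)
qed

text \<open>If both shifted digits stay in range, their number is below \<open>M^2\<close>, so the
  reduction does nothing and the digits can be read off.\<close>

lemma nat_mod_no_carry:
  fixes a c :: int and x M :: nat
  assumes "int (x mod M) + a \<in> {0..<int M}" "int (x div M) + c \<in> {0..<int M}"
  shows "int (nat ((int x + (a + int M * c)) mod int (M\<^sup>2)) mod M) = int (x mod M) + a"
    and "int (nat ((int x + (a + int M * c)) mod int (M\<^sup>2)) div M) = int (x div M) + c"
proof -
  define y where "y = int (x mod M) + a"
  define z where "z = int (x div M) + c"
  have yz: "0 \<le> y" "y < int M" "0 \<le> z" "z < int M" using assms by (auto simp: y_def z_def)
  have "int x = int (x mod M) + int M * int (x div M)"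
    by (metis mod_mult_div_eq of_nat_add of_nat_mult)
  then have eq: "int x + (a + int M * c) = y + int M * z" by (simp add: y_def z_def algebra_simps)
  have "int M * z \<le> int M * (int M - 1)" using yz by (intro mult_left_mono) auto
  then have "y + int M * z < int (M\<^sup>2)" using yz by (simp add: power2_eq_square algebra_simps)
  moreover have nn: "0 \<le> y + int M * z" using yz by simp
  ultimately have "(int x + (a + int M * c)) mod int (M\<^sup>2) = y + int M * z" unfolding eq by simp
  then have *: "int (nat ((int x + (a + int M * c)) mod int (M\<^sup>2))) = y + int M * z" using nn by simp
  show "int (nat ((int x + (a + int M * c)) mod int (M\<^sup>2)) mod M) = int (x mod M) + a"
  proof -
    have "int (nat ((int x + (a + int M * c)) mod int (M\<^sup>2)) mod M) = (y + int M * z) mod int M"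
      by (simp only: zmod_int *)
    then show ?thesis using yz unfolding y_def[symmetric] by simp
  qed
  show "int (nat ((int x + (a + int M * c)) mod int (M\<^sup>2)) div M) = int (x div M) + c"
  proof -
    have "int (nat ((int x + (a + int M * c)) mod int (M\<^sup>2)) div M) = (y + int M * z) div int M"
      by (simp only: zdiv_int *)
    then show ?thesis using yz unfolding z_def[symmetric] by simp
  qed
qed

definition vec_of_complex :: "complex \<Rightarrow> real^2" where
  "vec_of_complex z = (\<chi> i. if i = 1 then Re z else Im z)"

lemma dist_vec_of_complex: "dist (vec_of_complex z) (vec_of_complex w) = cmod (z - w)"
  by (simp add: vec_of_complex_def dist_vec_def L2_set_def UNIV_2 dist_real_def cmod_def)

theorem theorem1:
  fixes f :: "int poly" and c :: "real^2 \<Rightarrow> nat"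
  assumes "degree f \<ge> 1" and "lead_coeff f \<ge> 1"
    and "finite (range c)"
  shows "\<exists>x y n. x \<noteq> y \<and> c x = c y \<and> dist x y = real_of_int (poly f n)"
proof (rule ccontr)
  assume contr: "\<not> ?thesis"
  obtain m :: int where m: "\<And>n. n \<ge> m \<Longrightarrow> poly f n \<ge> 1"
    using exists_positive_shift[OF assms(2)] by blast
  define g where "g = pcompose f [:m, 1:]"
  have "lead_coeff g = lead_coeff f"
    unfolding g_def by (subst lead_coeff_comp) auto
  then have g: "degree g \<ge> 1" "lead_coeff g \<ge> 1"
    using assms by (simp_all add: g_def degree_pcompose)
  have g_f: "poly g n = poly f (m + n)" for n by (simp add: g_def poly_pcompose)
  have g_pos: "poly g (int n) \<ge> 1" for n unfolding g_f by (rule m) simp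
  define k where "k = card (range c)"
  have k1: "k \<ge> 1" using assms(3) by (simp add: k_def Suc_le_eq card_gt_0_iff)
  \<comment> \<open>With these values the normalised loss \<delta> + 2 / J + 1 / T is three times 1
    / (4 k), which is below 1 / k.\<close>
  define \<delta> where "\<delta> = 1 / (4 * real k)"
  define T where "T = 4 * k"
  define J where "J = 8 * k"
  have "\<delta> > 0" using k1 by (simp add: \<delta>_def)
  from spectral_lower_bound[OF this g, of T J] obtain b :: nat and N :: "nat \<Rightarrow> nat" where
    b2: "b \<ge> 2" and N1: "\<And>t. N t \<ge> 1" and
    spec: "\<And>\<theta>. \<forall>i. real b * \<theta> (i + 2) + real b * \<theta> i = \<theta> (i + 1) \<Longrightarrow>
      - (\<delta> * T * J + 2 * T + J) \<le>
      (\<Sum>t<T. \<Sum>j<J. (\<Sum>n<N t. cos (2 * pi * (of_int (poly g (int n)) * \<theta> j))) / real (N t))"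
    by blast
  \<comment> \<open>A root of v^2 = v - b^2 of modulus \<open>b\<close>, so \<open>u = v / b\<close>
    is a unit vector with \<open>u + 1 / u = 1 / b\<close>.\<close>
  define v where "v = Complex (1/2) (sqrt ((real b)\<^sup>2 - 1/4))"
  have b4: "(real b)\<^sup>2 \<ge> 4" using b2 power_mono[of 2 "real b" 2] by simp
  have v2: "v\<^sup>2 = v - of_int ((int b)\<^sup>2)"
    using b4 by (simp add: v_def complex_eq_iff power2_eq_square)
  have vnorm: "cmod v = real b"
    using b4 by (simp add: v_def cmod_def power2_eq_square)
  define P where "P = (\<lambda>j. fst (qpow (int b) j))"
  define Q where "Q = (\<lambda>j. snd (qpow (int b) j))"
  have vpow: "v ^ j = of_int (P j) + of_int (Q j) * v" for j
    unfolding P_def Q_def by (rule qpow_power[OF v2])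
  define S where "S = (SIGMA t:{..<T}. SIGMA j:{..<J}. {..<N t})"
  \<comment> \<open>The displacement \<open>g n * u ^ j\<close> equals
    \<open>g n * b ^ (J - j) * v ^ j / b ^ J\<close>; with the common denominator
    \<open>b ^ J\<close> its coordinates in the basis \<open>1, v\<close> are the integers
    \<open>dx\<close> and \<open>dy\<close>.\<close>
  define dx where "dx = (\<lambda>(t::nat,j,n). poly g (int n) * int b ^ (J - j) * P j)"
  define dy where "dy = (\<lambda>(t::nat,j,n). poly g (int n) * int b ^ (J - j) * Q j)"
  define wt where "wt = (\<lambda>(t,j::nat,n::nat). 1 / (real T * real J * real (N t)))"
  have finS: "finite S" by (simp add: S_def)
  have sumS: "(\<Sum>s\<in>S. h s) = (\<Sum>t<T. \<Sum>j<J. \<Sum>n<N t. h (t, j, n))" for h :: "_ \<Rightarrow> real"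
    unfolding S_def by (simp add: sum.Sigma split_def)
  define D where "D = (\<Sum>s\<in>S. nat \<bar>dx s\<bar> + nat \<bar>dy s\<bar>)"
  have D: "\<bar>dx s\<bar> \<le> int D" "\<bar>dy s\<bar> \<le> int D" if "s \<in> S" for s
  proof -
    have "nat \<bar>dx s\<bar> + nat \<bar>dy s\<bar> \<le> D" unfolding D_def using that finS by (intro member_le_sum) auto
    then show "\<bar>dx s\<bar> \<le> int D" "\<bar>dy s\<bar> \<le> int D" by linarith+
  qed
  \<comment> \<open>The box \<open>[0, M)\<^sup>2\<close> of lattice points is identified with the residues modulo \<open>M\<^sup>2\<close>; only
    displacements with a carry, at most a proportion \<open>2 * D / M\<close>, differ from lattice translations.\<close>
  define M where "M = 8 * k * D + 1"
  define pt where "pt = (\<lambda>x y :: int. (of_int x + of_int y * v) / of_nat b ^ J)"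
  define C where "C = (\<lambda>x. c (vec_of_complex (pt (int (x mod M)) (int (x div M)))))"
  define w where "w = (\<lambda>s. dx s + int M * dy s)"
  have wt_nonneg: "wt s \<ge> 0" for s by (auto simp: wt_def split_def)
  have wt_sum: "sum wt S = 1"
  proof -
    have "(\<Sum>n<N t. wt (t,j,n)) = 1 / (real T * real J)" for t j
      using N1[of t] by (simp add: wt_def)
    then show ?thesis using k1 by (simp add: sumS T_def J_def)
  qed
  have pt_dist: "cmod (pt (x + dx (t,j,n)) (y + dy (t,j,n)) - pt x y) = real_of_int (poly g (int n))"
    if "j < J" for x y t j n
  proof -
    have "pt (x + dx (t,j,n)) (y + dy (t,j,n)) - pt x y =
      of_int (poly g (int n)) * (of_nat b ^ (J - j) * (of_int (P j) + of_int (Q j) * v)) / of_nat b ^ J"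
      by (simp add: pt_def dx_def dy_def algebra_simps add_divide_distrib diff_divide_distrib)
    also have "cmod \<dots> = real_of_int (poly g (int n)) * (real b ^ (J - j) * real b ^ j) / real b ^ J"
      using g_pos[of n] by (simp add: vpow[symmetric] norm_mult norm_divide norm_power vnorm)
    also have "real b ^ (J - j) * real b ^ j = real b ^ J" using that by (simp flip: power_add)
    finally show ?thesis using b2 by simp
  qed
  have count: "card {x\<in>{..<M\<^sup>2}. C (nat ((int x + w s) mod int (M\<^sup>2))) = C x} \<le> 2 * D * M" if s: "s \<in> S" for s
  proof -
    obtain t j n where tjn: "s = (t, j, n)" "j < J" using s by (auto simp: S_def)
    have "C (nat ((int x + w s) mod int (M\<^sup>2))) \<noteq> C x"
      if "int (x mod M) + dx s \<in> {0..<int M}" "int (x div M) + dy s \<in> {0..<int M}" for x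
    proof
      assume eq: "C (nat ((int x + w s) mod int (M\<^sup>2))) = C x"
      define p where "p = vec_of_complex (pt (int (x mod M) + dx s) (int (x div M) + dy s))"
      define q where "q = vec_of_complex (pt (int (x mod M)) (int (x div M)))"
      have "c p = c q" using eq unfolding C_def w_def nat_mod_no_carry[OF that] by (simp add: p_def q_def)
      moreover have d: "dist p q = real_of_int (poly f (m + int n))"
        unfolding p_def q_def dist_vec_of_complex tjn pt_dist[OF tjn(2)] g_f ..
      moreover have "p \<noteq> q" using d g_pos[of n] by (auto simp: g_f)
      ultimately show False using contr by blast
    qed
    then have "{x\<in>{..<M\<^sup>2}. C (nat ((int x + w s) mod int (M\<^sup>2))) = C x} \<subseteq>
      {x\<in>{..<M\<^sup>2}. \<not> (int (x mod M) + dx s \<in> {0..<int M} \<and> int (x div M) + dy s \<in> {0..<int M})}"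
      by blast
    then have "card {x\<in>{..<M\<^sup>2}. C (nat ((int x + w s) mod int (M\<^sup>2))) = C x} \<le>
      card {x\<in>{..<M\<^sup>2}. \<not> (int (x mod M) + dx s \<in> {0..<int M} \<and> int (x div M) + dy s \<in> {0..<int M})}"
      by (intro card_mono) auto
    also have "\<dots> \<le> 2 * D * M" by (rule card_carry_le[OF D[OF s]])
    finally show ?thesis .
  qed
  have h: "- (3 / (4 * real k)) \<le> (\<Sum>s\<in>S. wt s * cos (2 * pi * (real \<xi> * (of_int (w s) / real (M\<^sup>2)))))" for \<xi>
  proof -
    define \<alpha> where "\<alpha> = real \<xi> / real (M\<^sup>2)"
    \<comment> \<open>The quotient of powers replaces \<open>b ^ (J - j)\<close> so that the
      recurrence holds for all indices, including those beyond \<open>J\<close>, where natural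
      subtraction would truncate.\<close>
    define \<theta> where "\<theta> = (\<lambda>j. real b ^ J / real b ^ j * ((of_int (P j) + real M * of_int (Q j)) * \<alpha>))"
    have PQ: "P (j + 2) = P (j + 1) - (int b)\<^sup>2 * P j" "Q (j + 2) = Q (j + 1) - (int b)\<^sup>2 * Q j" for j
      by (simp_all add: P_def Q_def algebra_simps)
    have "real b * \<theta> (i + 2) + real b * \<theta> i = \<theta> (i + 1)" for i
      unfolding \<theta>_def PQ using b2 by (simp add: field_simps power2_eq_square)
    then have rec: "\<forall>i. real b * \<theta> (i + 2) + real b * \<theta> i = \<theta> (i + 1)" by blast
    have phase: "real \<xi> * (of_int (w (t,j,n)) / real (M\<^sup>2)) = of_int (poly g (int n)) * \<theta> j" if "j < J" for t j n
    proof -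
      have "real b ^ J / real b ^ j = real b ^ (J - j)" using that b2 by (simp add: power_diff)
      then have "\<theta> j = real b ^ (J - j) * ((of_int (P j) + real M * of_int (Q j)) * \<alpha>)"
        by (simp only: \<theta>_def)
      then show ?thesis by (simp add: w_def dx_def dy_def \<alpha>_def algebra_simps add_divide_distrib)
    qed
    have "real T * real J > 0" using k1 by (simp add: T_def J_def)
    then have "- (3 / (4 * real k)) = - (\<delta> * T * J + 2 * T + J) / (real T * real J)"
      using k1 by (simp add: \<delta>_def T_def J_def field_simps)
    also have "\<dots> \<le> (\<Sum>t<T. \<Sum>j<J. (\<Sum>n<N t. cos (2 * pi * (of_int (poly g (int n)) * \<theta> j))) / real (N t)) / (real T * real J)"
      by (intro divide_right_mono spec[OF rec]) simp
    also have "\<dots> = (\<Sum>t<T. \<Sum>j<J. \<Sum>n<N t. wt (t,j,n) * cos (2 * pi * (of_int (poly g (int n)) * \<theta> j)))"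
      by (simp add: sum_divide_distrib wt_def mult_ac)
    also have "\<dots> = (\<Sum>s\<in>S. wt s * cos (2 * pi * (real \<xi> * (of_int (w s) / real (M\<^sup>2)))))"
      unfolding sumS by (intro sum.cong refl) (simp only: phase lessThan_iff)
    finally show ?thesis .
  qed
  have M1: "M\<^sup>2 \<ge> 1" by (simp add: M_def)
  have "C ` {..<M\<^sup>2} \<subseteq> range c" by (auto simp: C_def)
  \<comment> \<open>At least \<open>M^2 / (4 * k)\<close> weighted monochromatic pairs are forced,
    but only carries can produce them, at most \<open>2 * D * M\<close>. So
    \<open>M \<le> 8 * k * D\<close>, against the choice of \<open>M\<close>.\<close>
  from ratio_bound[OF M1 assms(3) this finS wt_nonneg wt_sum _ h]
  have "(1 / real k - 3 / (4 * real k)) * real (M\<^sup>2) \<le>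
    (\<Sum>s\<in>S. wt s * real (card {x\<in>{..<M\<^sup>2}. C (nat ((int x + w s) mod int (M\<^sup>2))) = C x}))"
    by (simp add: k_def)
  also have "\<dots> \<le> (\<Sum>s\<in>S. wt s * real (2 * D * M))"
    using count wt_nonneg by (intro sum_mono mult_left_mono) (auto simp only: of_nat_le_iff)
  also have "\<dots> = real (2 * D * M)" by (simp add: wt_sum flip: sum_distrib_right)
  also have "1 / real k - 3 / (4 * real k) = 1 / (4 * real k)" using k1 by (simp add: field_simps)
  finally have "real (M * M) \<le> real (8 * k * D * M)"
    using k1 by (simp add: field_simps power2_eq_square)
  then have "M * M \<le> 8 * k * D * M" by (simp only: of_nat_le_iff)
  then have "M \<le> 8 * k * D" by (simp add: M_def)
  then show False by (simp add: M_def)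
qed

end
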